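(* Let $f_1,f_2\in\Bbbk\langle x_1,\dots,x_g\rangle$ satisfy $f_i(\Bbbk^g)\neq\{0\}$ for $i=1,2$ (i.e., each $f_i$ is nonzero at some point of $\Bbbk^g$). Then $\mathscr{Z}(f_1)\subseteq\mathscr{Z}(f_2)$ if and only if each irreducible factor of $f_1$ is, up to stable associativity, an irreducible factor of $f_2$ (i.e., each irreducible factor of $f_1$ is stably associated to some irreducible factor of $f_2$).
   Context: $\Bbbk$ is an algebraically closed field of characteristic $0$; $\Bbbk\langle\boldsymbol{x}\rangle=\Bbbk\langle x_1,\dots,x_g\rangle$ is the free associative unital $\Bbbk$-algebra. The free (singularity) locus of $f\in\Bbbk\langle\boldsymbol{x}\rangle$ is $\mathscr{Z}(f)=\bigcup_{n\in\mathbb{N}}\mathscr{Z}_n(f)$, where $\mathscr{Z}_n(f)=\{X\in M_n(\Bbbk)^g:\det f(X)=0\}$. A noncommutative polynomial is irreducible if it is nonconstant and is not a product of two nonconstant noncommutative polynomials; the irreducible factors of $f$ are the irreducible polynomials occurring in factorizations of $f$ into irreducible polynomials (up to a nonzero scalar). Square matrices $f_1\in M_{d_1}(\Bbbk\langle\boldsymbol{x}\rangle)$ and $f_2\in M_{d_2}(\Bbbk\langle\boldsymbol{x}\rangle)$ (in particular, polynomials, with $d_1=d_2=1$) are stably associated if there are nonnegative integers $e_1,e_2$ with $d_1+e_1=d_2+e_2$ and $P,Q\in \mathrm{GL}_{d_1+e_1}(\Bbbk\langle\boldsymbol{x}\rangle)$ such that $f_1\oplus I_{e_1}=P(f_2\oplus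 I_{e_2})Q$. *)

theory Defs
  imports
    "HOL-Library.Poly_Mapping"
    "HOL-Computational_Algebra.Polynomial"
    "Jordan_Normal_Form.Determinant"
begin

text \<open>
  Words over \<open>'g\<close>. Lists are wrapped in a type of their own so that concatenation can be
  registered as the (non-commutative) addition of a \<^class>\<open>monoid_add\<close>; the finitely supported
  functions on words then form, with the convolution product of
  \<^theory>\<open>HOL-Library.Poly_Mapping\<close>, the free associative unital algebra on the letters.
\<close>

datatype 'g free_monoid = Word (letters: "'g list")

instantiation free_monoid :: (type) monoid_add
begin

definition zero_free_monoid :: "'a free_monoid" where
  "0 = Word []"

definition plus_free_monoid :: "'a free_monoid \<Rightarrow> 'a free_monoid \<Rightarrow> 'a free_monoid" where
  "v + w = Word (letters v @ letters w)"

instance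
  by standard (simp_all add: zero_free_monoid_def plus_free_monoid_def)

end

type_synonym ('g, 'k) free_algebra = "'g free_monoid \<Rightarrow>\<^sub>0 'k"

definition nc_const :: "'k::field \<Rightarrow> ('g, 'k) free_algebra" where
  "nc_const c = Poly_Mapping.single 0 c"

definition nonconstant :: "('g, 'k::field) free_algebra \<Rightarrow> bool" where
  "nonconstant f \<longleftrightarrow> f \<notin> range nc_const"

definition nc_irreducible :: "('g, 'k::field) free_algebra \<Rightarrow> bool" where
  "nc_irreducible f \<longleftrightarrow>
     nonconstant f \<and> \<not> (\<exists>p q. nonconstant p \<and> nonconstant q \<and> f = p * q)"

text \<open>Factors are taken up to a nonzero scalar; a nonzero constant has none.\<close>

definition irreducible_factor :: "('g, 'k::field) free_algebra \<Rightarrow> ('g, 'k) free_algebra \<Rightarrow> bool" where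
  "irreducible_factor p f \<longleftrightarrow>
     (\<exists>qs q c. (\<forall>r\<in>set qs. nc_irreducible r) \<and> f = prod_list qs \<and>
        q \<in> set qs \<and> c \<noteq> 0 \<and> p = nc_const c * q)"

definition eval_point :: "('g, 'k::field) free_algebra \<Rightarrow> ('g \<Rightarrow> 'k) \<Rightarrow> 'k" where
  "eval_point f a = (\<Sum>w\<in>Poly_Mapping.keys f. Poly_Mapping.lookup f w * prod_list (map a (letters w)))"

definition word_mat :: "nat \<Rightarrow> ('g \<Rightarrow> 'k::field mat) \<Rightarrow> 'g free_monoid \<Rightarrow> 'k mat" where
  "word_mat n X w = foldr (\<lambda>i M. X i * M) (letters w) (1\<^sub>m n)"

text \<open>
  The linear combination of the word matrices is formed entrywise, because \<^typ>\<open>'k mat\<close>, which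
  contains matrices of all sizes, has no additive monoid structure.
\<close>

definition eval_mat :: "nat \<Rightarrow> ('g, 'k::field) free_algebra \<Rightarrow> ('g \<Rightarrow> 'k mat) \<Rightarrow> 'k mat" where
  "eval_mat n f X = mat n n (\<lambda>(i, j). \<Sum>w\<in>Poly_Mapping.keys f. Poly_Mapping.lookup f w * word_mat n X w $$ (i, j))"

definition free_locus_at :: "nat \<Rightarrow> ('g, 'k::field) free_algebra \<Rightarrow> ('g \<Rightarrow> 'k mat) set" where
  "free_locus_at n f = {X. (\<forall>i. X i \<in> carrier_mat n n) \<and> det (eval_mat n f X) = 0}"

definition free_locus :: "('g, 'k::field) free_algebra \<Rightarrow> ('g \<Rightarrow> 'k mat) set" where
  "free_locus f = (\<Union>n\<in>{1..}. free_locus_at n f)"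

text \<open>
  \<^const>\<open>invertible_mat\<close> asks for a square matrix with a two-sided inverse, so \<open>P\<close> and \<open>Q\<close> below range
  over the general linear group of the free algebra.
\<close>

definition stably_associated ::
    "('g, 'k::field) free_algebra mat \<Rightarrow> ('g, 'k) free_algebra mat \<Rightarrow> bool" where
  "stably_associated A B \<longleftrightarrow> square_mat A \<and> square_mat B \<and>
     (\<exists>d e P Q. dim_row A + d = dim_row B + e \<and>
        P \<in> carrier_mat (dim_row A + d) (dim_row A + d) \<and> invertible_mat P \<and>
        Q \<in> carrier_mat (dim_row A + d) (dim_row A + d) \<and> invertible_mat Q \<and>
        diag_block_mat [A, 1\<^sub>m d] = P * diag_block_mat [B, 1\<^sub>m e] * Q)"

definition mat_of_poly :: "('g, 'k::field) free_algebra \<Rightarrow> ('g, 'k) free_algebra mat" where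
  "mat_of_poly f = mat 1 1 (\<lambda>_. f)"

end

theory Submission
  imports Defs
begin

text \<open>
  Fix a point \<open>a\<close> with \<open>f\<^sub>1(a) \<noteq> 0 \<noteq> f\<^sub>2(a)\<close> and let \<open>p\<close> be an irreducible polynomial with \<open>p(a) \<noteq> 0\<close>. The
  left module \<open>M\<close> of polynomials modulo left multiples of \<open>p\<close> is the direct sum of the
  \<open>(x\<^sub>i - a\<^sub>i)M\<close>, and the coordinate maps of this decomposition preserve the finite-dimensional space of
  polynomials of degree less than that of \<open>p\<close>, which generates \<open>M\<close>. Letting the variables act through
  the coordinate maps turns this space into a second, finite-dimensional module \<open>V\<^sub>p\<close>.

  Let \<open>S\<close> be a simple submodule of \<open>V\<^sub>p\<close>. If \<open>S\<close> is a quotient of a submodule of \<open>V\<^sub>q\<close>, where \<open>q\<close> is an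
  irreducible factor of \<open>f\<^sub>2\<close>, then the quotient map extends to an isomorphism between the modules
  of \<open>q\<close> and \<open>p\<close>, so that \<open>p\<close> and \<open>q\<close> are stably associated. Otherwise some \<open>h\<close> with \<open>h(0) = 0\<close>
  annihilates \<open>V\<^sub>q\<close> for every irreducible factor \<open>q\<close> of \<open>f\<^sub>2\<close> but fixes a nonzero vector of \<open>S\<close>. Evaluating at
  the companion matrices of \<open>1 - h\<close>, shifted by \<open>a\<close>, turns these two properties into
  \<open>det q(X) \<noteq> 0\<close> and \<open>det p(X) = 0\<close>.
\<close>

subsection \<open>The free algebra\<close>

definition nc_var :: "'g \<Rightarrow> ('g, 'k::field) free_algebra" where
  "nc_var i = Poly_Mapping.single (Word [i]) 1"

lemma nc_const_0 [simp]: "nc_const 0 = 0"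
  by (simp add: nc_const_def)

lemma nc_const_1 [simp]: "nc_const 1 = 1"
  by (simp add: nc_const_def)

lemma nc_const_add: "nc_const (c + d) = nc_const c + nc_const d"
  by (simp add: nc_const_def single_add)

lemma nc_const_mult: "nc_const (c * d) = nc_const c * nc_const d"
  by (simp add: nc_const_def mult_single)

lemma nc_const_uminus: "nc_const (- c) = - nc_const c"
  by (simp add: nc_const_def single_uminus)

lemma nc_const_eq_0_iff [simp]: "nc_const c = 0 \<longleftrightarrow> c = 0"
  by (metis nc_const_def lookup_single_eq lookup_zero single_zero)

lemma sum_single_lookup:
  fixes f :: "'a \<Rightarrow>\<^sub>0 'b::comm_monoid_add"
  shows "(\<Sum>w\<in>Poly_Mapping.keys f. Poly_Mapping.single w (Poly_Mapping.lookup f w)) = f"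
  by (rule poly_mapping_eqI) (auto simp: lookup_sum lookup_single when_def in_keys_iff)

lemma free_algebra_induct [case_names zero single add]:
  fixes f :: "('g, 'k::field) free_algebra"
  assumes "P 0" "\<And>w c. P (Poly_Mapping.single w c)" "\<And>f g. P f \<Longrightarrow> P g \<Longrightarrow> P (f + g)"
  shows "P f"
proof -
  have sum: "P (\<Sum>w\<in>A. Poly_Mapping.single w (Poly_Mapping.lookup f w))" if "finite A" for A
    using that by (induction A) (auto intro: assms)
  show ?thesis using sum[OF finite_keys, of f] by (simp add: sum_single_lookup)
qed

lemma single_Word_Cons:
  "Poly_Mapping.single (Word (i # w)) c = nc_var i * Poly_Mapping.single (Word w) c"
  by (simp add: nc_var_def mult_single plus_free_monoid_def)

lemma single_Word_Nil: "Poly_Mapping.single (Word []) c = nc_const c"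
  by (simp add: nc_const_def zero_free_monoid_def)

text \<open>Words grow by left multiplication with a variable, so an operator defined through words
  only has to be understood on constants, sums and such products.\<close>

lemma nc_poly_induct [case_names const add var]:
  fixes f :: "('g, 'k::field) free_algebra"
  assumes "\<And>c. P (nc_const c)" "\<And>f g. P f \<Longrightarrow> P g \<Longrightarrow> P (f + g)" "\<And>i f. P f \<Longrightarrow> P (nc_var i * f)"
  shows "P f"
proof -
  have "P (Poly_Mapping.single (Word w) c)" for w c
    by (induction w) (simp_all add: assms single_Word_Cons single_Word_Nil)
  then have "P (Poly_Mapping.single w c)" for w c
    by (cases w) simp
  with assms show ?thesis
    by (induction f rule: free_algebra_induct) (auto simp flip: nc_const_0)
qed

lemma nc_const_commute: "nc_const c * f = f * nc_const c"
proof (induction f rule: free_algebra_induct)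
  case (single w d)
  then show ?case by (simp add: nc_const_def mult_single mult.commute)
qed (simp_all add: distrib_left distrib_right)

lemma nc_const_left_commute: "f * (nc_const c * g) = nc_const c * (f * g)"
  by (metis mult.assoc nc_const_commute)

lemma nc_const_single: "nc_const c * Poly_Mapping.single w d = Poly_Mapping.single w (c * d)"
  by (simp add: nc_const_def mult_single)

lemma nc_const_nc_const_commute: "nc_const c * (nc_const d * f) = nc_const d * (nc_const c * f)"
  by (rule nc_const_left_commute)

lemma lookup_nc_const_mult: "Poly_Mapping.lookup (nc_const c * f) w = c * Poly_Mapping.lookup f w"
proof (induction f rule: free_algebra_induct)
  case (single v d)
  then show ?case by (simp add: nc_const_def mult_single lookup_single when_def)
qed (simp_all add: distrib_left lookup_add)

subsection \<open>Linear extension\<close>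

text \<open>The map \<open>s\<close> places the scalars in the target ring: the identity serves
  evaluations, \<open>nc_const\<close> serves linear operators on the free algebra itself.\<close>

definition lin_ext ::
    "('k::field \<Rightarrow> 'b::ring_1) \<Rightarrow> ('g free_monoid \<Rightarrow> 'b) \<Rightarrow> ('g, 'k) free_algebra \<Rightarrow> 'b" where
  "lin_ext s \<phi> f = (\<Sum>w\<in>Poly_Mapping.keys f. s (Poly_Mapping.lookup f w) * \<phi> w)"

locale scalar_hom =
  fixes s :: "'k::field \<Rightarrow> 'b::ring_1"
  assumes s_0: "s 0 = 0" and s_1: "s 1 = 1"
    and s_add: "s (c + d) = s c + s d" and s_mult: "s (c * d) = s c * s d"
begin

lemma lin_ext_0 [simp]: "lin_ext s \<phi> 0 = 0"
  by (simp add: lin_ext_def)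

lemma lin_ext_add: "lin_ext s \<phi> (f + g) = lin_ext s \<phi> f + lin_ext s \<phi> g"
  unfolding lin_ext_def by (rule setsum_keys_plus_distrib) (simp_all add: s_0 s_add distrib_right)

lemma lin_ext_single: "lin_ext s \<phi> (Poly_Mapping.single w c) = s c * \<phi> w"
  by (simp add: lin_ext_def s_0)

lemma lin_ext_const: "lin_ext s \<phi> (nc_const c) = s c * \<phi> 0"
  by (simp add: nc_const_def lin_ext_single)

lemma lin_ext_scale: "lin_ext s \<phi> (nc_const c * f) = s c * lin_ext s \<phi> f"
proof (induction f rule: free_algebra_induct)
  case (single w d)
  then show ?case by (simp add: nc_const_def mult_single lin_ext_single s_mult mult.assoc)
qed (simp_all add: distrib_left lin_ext_add)

lemma lin_ext_var: "lin_ext s \<phi> (nc_var i * f) = lin_ext s (\<lambda>w. \<phi> (Word (i # letters w))) f"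
proof (induction f rule: free_algebra_induct)
  case (single w d)
  then show ?case by (simp add: nc_var_def mult_single lin_ext_single plus_free_monoid_def)
qed (simp_all add: distrib_left lin_ext_add)

lemma lin_ext_add_fun: "lin_ext s (\<lambda>w. \<phi> w + \<psi> w) f = lin_ext s \<phi> f + lin_ext s \<psi> f"
  by (simp add: lin_ext_def distrib_left sum.distrib)

end

interpretation scalar_id: scalar_hom "\<lambda>c :: 'k::field. c"
  by unfold_locales simp_all

interpretation scalar_nc: scalar_hom "nc_const :: 'k::field \<Rightarrow> ('g, 'k) free_algebra"
  by unfold_locales (simp_all add: nc_const_add nc_const_mult)

subsection \<open>Evaluation\<close>

lemma eval_point_lin_ext: "eval_point f a = lin_ext (\<lambda>c. c) (\<lambda>w. prod_list (map a (letters w))) f"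
  by (simp add: eval_point_def lin_ext_def)

lemma eval_point_0 [simp]: "eval_point 0 a = 0"
  by (simp add: eval_point_def)

lemma eval_point_add [simp]: "eval_point (f + g) a = eval_point f a + eval_point g a"
  by (simp add: eval_point_lin_ext scalar_id.lin_ext_add)

lemma eval_point_const [simp]: "eval_point (nc_const c) a = c"
  by (simp add: eval_point_lin_ext scalar_id.lin_ext_const zero_free_monoid_def)

lemma eval_point_1 [simp]: "eval_point 1 a = 1"
  by (metis nc_const_1 eval_point_const)

lemma eval_point_var_mult: "eval_point (nc_var i * f) a = a i * eval_point f a"
  by (simp add: eval_point_lin_ext scalar_id.lin_ext_var)
    (simp add: lin_ext_def sum_distrib_left mult.left_commute)

lemma eval_point_scale: "eval_point (nc_const c * f) a = c * eval_point f a"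
  by (simp add: eval_point_lin_ext scalar_id.lin_ext_scale)

lemma eval_point_mult [simp]: "eval_point (f * g) a = eval_point f a * eval_point g a"
  by (induction f rule: nc_poly_induct)
    (simp_all add: eval_point_scale eval_point_var_mult distrib_right mult.assoc)

lemma eval_point_var [simp]: "eval_point (nc_var i) a = a i"
  using eval_point_var_mult[of i 1 a] by simp

lemma eval_point_uminus [simp]: "eval_point (- f) a = - eval_point f a"
  by (metis add_eq_0_iff eval_point_0 eval_point_add neg_eq_iff_add_eq_0 add.commute)

lemma eval_point_diff [simp]: "eval_point (f - g) a = eval_point f a - eval_point g a"
  by (metis diff_conv_add_uminus eval_point_add eval_point_uminus)

lemma eval_point_origin:
  fixes f :: "('g, 'k::field) free_algebra"
  shows "eval_point f (\<lambda>_. 0) = Poly_Mapping.lookup f 0"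
proof (induction f rule: free_algebra_induct)
  case (single w c)
  have "prod_list (map (\<lambda>_. 0 :: 'k) (letters w)) = (if w = 0 then 1 else 0)"
    by (cases w; cases "letters w") (auto simp: zero_free_monoid_def)
  then show ?case
    by (auto simp: eval_point_lin_ext scalar_id.lin_ext_single lookup_single when_def)
qed (simp_all add: lookup_add)

text \<open>The constant coefficient is the value at the origin, hence multiplicative; so a
  vanishing constant term survives left multiplication.\<close>

lemma lookup_mult_0:
  fixes f g :: "('g, 'k::field) free_algebra"
  shows "Poly_Mapping.lookup (f * g) 0 = Poly_Mapping.lookup f 0 * Poly_Mapping.lookup g 0"
  by (simp flip: eval_point_origin)

section \<open>Evaluation at tuples of matrices\<close>

lemma word_mat_carrier:
  assumes "\<And>i. X i \<in> carrier_mat n n"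
  shows "word_mat n X w \<in> carrier_mat n n"
proof -
  have "foldr (\<lambda>i M. X i * M) l (1\<^sub>m n) \<in> carrier_mat n n" for l
    by (induction l) (auto intro!: mult_carrier_mat assms)
  then show ?thesis by (simp add: word_mat_def)
qed

lemma eval_mat_carrier [simp]: "eval_mat n f X \<in> carrier_mat n n"
  by (simp add: eval_mat_def)

lemma eval_mat_dim [simp]: "dim_row (eval_mat n f X) = n" "dim_col (eval_mat n f X) = n"
  by (simp_all add: eval_mat_def)

lemma eval_mat_index:
  "i < n \<Longrightarrow> j < n \<Longrightarrow> eval_mat n f X $$ (i, j) = lin_ext (\<lambda>c. c) (\<lambda>w. word_mat n X w $$ (i, j)) f"
  by (simp add: eval_mat_def lin_ext_def)

lemma eval_mat_add: "eval_mat n (f + g) X = eval_mat n f X + eval_mat n g X"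
  by (rule eq_matI) (simp_all add: eval_mat_index scalar_id.lin_ext_add)

lemma eval_mat_scale: "eval_mat n (nc_const c * f) X = c \<cdot>\<^sub>m eval_mat n f X"
  by (rule eq_matI) (simp_all add: eval_mat_index scalar_id.lin_ext_scale)

lemma eval_mat_const: "eval_mat n (nc_const c) X = c \<cdot>\<^sub>m 1\<^sub>m n"
  by (rule eq_matI)
    (simp_all add: eval_mat_index scalar_id.lin_ext_const word_mat_def zero_free_monoid_def)

lemma eval_mat_1: "eval_mat n 1 X = 1\<^sub>m n"
  using eval_mat_const[of n 1 X] by (auto intro!: eq_matI)

lemma eval_mat_0: "eval_mat n 0 X = 0\<^sub>m n n"
  by (rule eq_matI) (simp_all add: eval_mat_index)

lemma eval_mat_var_mult:
  assumes X: "\<And>i. X i \<in> carrier_mat n n"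
  shows "eval_mat n (nc_var i * f) X = X i * eval_mat n f X"
proof (rule eq_matI)
  fix r c assume "r < dim_row (X i * eval_mat n f X)" "c < dim_col (X i * eval_mat n f X)"
  with X[of i] have rc: "r < n" "c < n" by auto
  note wm = word_mat_carrier[of X n, OF X]
  have "eval_mat n (nc_var i * f) X $$ (r, c)
      = lin_ext (\<lambda>c. c) (\<lambda>w. (X i * word_mat n X w) $$ (r, c)) f"
    using rc by (simp add: eval_mat_index scalar_id.lin_ext_var word_mat_def)
  also have "\<dots> = lin_ext (\<lambda>c. c) (\<lambda>w. \<Sum>k<n. X i $$ (r, k) * word_mat n X w $$ (k, c)) f"
    using rc X[of i] carrier_matD[OF wm]
    by (simp add: scalar_prod_def lessThan_atLeast0)
  also have "\<dots> = (\<Sum>k<n. X i $$ (r, k) * lin_ext (\<lambda>c. c) (\<lambda>w. word_mat n X w $$ (k, c)) f)"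
    unfolding lin_ext_def sum_distrib_left
    by (subst sum.swap) (simp add: mult.left_commute)
  also have "\<dots> = (X i * eval_mat n f X) $$ (r, c)"
    using rc X[of i] by (simp add: scalar_prod_def lessThan_atLeast0 eval_mat_index)
  finally show "eval_mat n (nc_var i * f) X $$ (r, c) = (X i * eval_mat n f X) $$ (r, c)" .
qed (use X[of i] in auto)

lemma eval_mat_mult:
  assumes X: "\<And>i. X i \<in> carrier_mat n n"
  shows "eval_mat n (f * g) X = eval_mat n f X * eval_mat n g X"
proof (induction f rule: nc_poly_induct)
  case (const c)
  show ?case
    unfolding eval_mat_scale eval_mat_const
    by (subst mult_smult_assoc_mat[of _ n n _ n]) auto
next
  case (add f f')
  then show ?case
    by (simp add: distrib_right eval_mat_add add_mult_distrib_mat[of _ n n _ _ n])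
next
  case (var i f)
  then show ?case
    using assoc_mult_mat[OF X[of i] eval_mat_carrier eval_mat_carrier, of f X g X]
    by (simp add: mult.assoc eval_mat_var_mult[of X n, OF X])
qed

lemma eval_mat_prod_list:
  assumes "\<And>i. X i \<in> carrier_mat n n"
  shows "det (eval_mat n (prod_list qs) X) = (\<Prod>q\<leftarrow>qs. det (eval_mat n q X))"
  by (induction qs) (simp_all add: eval_mat_1 eval_mat_mult[of X n, OF assms] det_mult[of _ n])

subsection \<open>Degree\<close>

text \<open>The inserted \<open>0\<close> is the empty word: it keeps the set nonempty and gives the
  zero polynomial degree 0.\<close>

definition nc_deg :: "('g, 'k::field) free_algebra \<Rightarrow> nat" where
  "nc_deg f = Max ((\<lambda>w. length (letters w)) ` insert 0 (Poly_Mapping.keys f))"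

text \<open>The strict bound makes \<open>deg_below (nc_deg p)\<close> the underlying space of
  \<open>V\<^sub>p\<close> and leaves only 0 in \<open>deg_below 0\<close>, where inductions on the
  bound start.\<close>

definition deg_below :: "nat \<Rightarrow> ('g, 'k::field) free_algebra set" where
  "deg_below d = {f. \<forall>w\<in>Poly_Mapping.keys f. length (letters w) < d}"

lemma deg_below_nc_deg: "f \<in> deg_below (Suc (nc_deg f))"
  by (simp add: deg_below_def nc_deg_def less_Suc_eq_le)

lemma deg_below_lookup:
  "f \<in> deg_below d \<longleftrightarrow> (\<forall>w. d \<le> length (letters w) \<longrightarrow> Poly_Mapping.lookup f w = 0)"
  by (auto simp: deg_below_def in_keys_iff not_le[symmetric])

lemma deg_below_zero [simp]: "0 \<in> deg_below d"
  by (simp add: deg_below_def)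

lemma deg_below_add: "f \<in> deg_below d \<Longrightarrow> g \<in> deg_below d \<Longrightarrow> f + g \<in> deg_below d"
  by (simp add: deg_below_lookup lookup_add)

lemma deg_below_diff: "f \<in> deg_below d \<Longrightarrow> g \<in> deg_below d \<Longrightarrow> f - g \<in> deg_below d"
  by (simp add: deg_below_lookup lookup_minus)

lemma deg_below_scale: "f \<in> deg_below d \<Longrightarrow> nc_const c * f \<in> deg_below d"
  by (simp add: deg_below_lookup lookup_nc_const_mult)

lemma deg_below_sum: "(\<And>x. x \<in> A \<Longrightarrow> f x \<in> deg_below d) \<Longrightarrow> sum f A \<in> deg_below d"
  by (induction A rule: infinite_finite_induct) (auto intro: deg_below_add)

lemma deg_below_mono: "d \<le> e \<Longrightarrow> deg_below d \<subseteq> deg_below e"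
  by (auto simp: deg_below_def)

lemma deg_below_0 [simp]: "deg_below 0 = {0}"
  by (auto simp: deg_below_def)

lemma deg_below_const: "nc_const c \<in> deg_below (Suc d)"
  by (auto simp: deg_below_def nc_const_def zero_free_monoid_def)

lemma deg_below_single: "length (letters w) < d \<Longrightarrow> Poly_Mapping.single w c \<in> deg_below d"
  by (auto simp: deg_below_def)

lemma nc_deg_ex:
  assumes "f \<noteq> 0"
  obtains w where "Poly_Mapping.lookup f w \<noteq> 0" "length (letters w) = nc_deg f"
proof -
  have "nc_deg f \<in> (\<lambda>w. length (letters w)) ` insert 0 (Poly_Mapping.keys f)"
    unfolding nc_deg_def by (rule Max_in) auto
  then consider "nc_deg f = 0" | w where "w \<in> Poly_Mapping.keys f" "nc_deg f = length (letters w)"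
    by (auto simp: zero_free_monoid_def)
  then show ?thesis
  proof cases
    case 1
    from assms obtain w where w: "w \<in> Poly_Mapping.keys f"
      by fastforce
    then have "length (letters w) \<le> nc_deg f"
      by (simp add: nc_deg_def)
    with 1 w show ?thesis by (intro that[of w]) (auto simp: in_keys_iff)
  qed (use that in \<open>auto simp: in_keys_iff\<close>)
qed

lemma nc_deg_less: "f \<in> deg_below d \<Longrightarrow> f \<noteq> 0 \<Longrightarrow> nc_deg f < d"
  by (metis deg_below_lookup nc_deg_ex not_le)

text \<open>Let \<open>u\<close> and \<open>v\<close> be words of maximal length in the two factors.
  Maximality forces every splitting of \<open>u + v\<close> into words of \<open>f\<close> and
  \<open>g\<close> to cut at the same place, so the coefficient of \<open>u + v\<close> is a product
  of two nonzero scalars.\<close>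

lemma nc_deg_mult:
  fixes f g :: "('g, 'k::field) free_algebra"
  assumes "f \<noteq> 0" "g \<noteq> 0"
  shows "f * g \<noteq> 0" "nc_deg (f * g) = nc_deg f + nc_deg g"
proof -
  let ?l = "\<lambda>w. length (letters w)"
  obtain u where u: "Poly_Mapping.lookup f u \<noteq> 0" "?l u = nc_deg f"
    using nc_deg_ex assms by blast
  obtain v where v: "Poly_Mapping.lookup g v \<noteq> 0" "?l v = nc_deg g"
    using nc_deg_ex assms by blast
  have fmax: "?l w \<le> nc_deg f" if "w \<in> Poly_Mapping.keys f" for w
    using that by (simp add: nc_deg_def)
  have gmax: "?l w \<le> nc_deg g" if "w \<in> Poly_Mapping.keys g" for w
    using that by (simp add: nc_deg_def)
  have uniq: "w = u \<and> x = v"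
    if "w \<in> Poly_Mapping.keys f" "x \<in> Poly_Mapping.keys g" "u + v = w + x" for w x
  proof -
    from that(3) have eq: "letters u @ letters v = letters w @ letters x"
      by (simp add: plus_free_monoid_def)
    then have "?l u + ?l v = ?l w + ?l x"
      by (metis length_append)
    with fmax[OF that(1)] gmax[OF that(2)] u v have "?l u = ?l w" by linarith
    with eq show ?thesis by (auto intro: free_monoid.expand)
  qed
  have "f * g = (\<Sum>w\<in>Poly_Mapping.keys f. Poly_Mapping.single w (Poly_Mapping.lookup f w))
      * (\<Sum>x\<in>Poly_Mapping.keys g. Poly_Mapping.single x (Poly_Mapping.lookup g x))"
    by (simp add: sum_single_lookup)
  then have fg: "f * g = (\<Sum>w\<in>Poly_Mapping.keys f. \<Sum>x\<in>Poly_Mapping.keys g.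
      Poly_Mapping.single (w + x) (Poly_Mapping.lookup f w * Poly_Mapping.lookup g x))"
    by (simp add: sum_product mult_single)
  have "Poly_Mapping.lookup (f * g) (u + v) = (\<Sum>w\<in>Poly_Mapping.keys f. \<Sum>x\<in>Poly_Mapping.keys g.
      (if w = u then if x = v then Poly_Mapping.lookup f w * Poly_Mapping.lookup g x else 0 else 0))"
    unfolding fg lookup_sum lookup_single when_def
    by (intro sum.cong refl) (use uniq in auto)
  also have "\<dots> = (\<Sum>w\<in>Poly_Mapping.keys f. if w = u then
      Poly_Mapping.lookup f u * Poly_Mapping.lookup g v else 0)"
    using v by (intro sum.cong refl) (auto simp: in_keys_iff)
  also have "\<dots> = Poly_Mapping.lookup f u * Poly_Mapping.lookup g v"
    using u by (simp add: in_keys_iff)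
  finally have uv: "Poly_Mapping.lookup (f * g) (u + v) \<noteq> 0"
    using u v by simp
  then show nz: "f * g \<noteq> 0" by auto
  have "f * g \<in> deg_below (Suc (nc_deg f + nc_deg g))"
    unfolding fg
  proof (intro deg_below_sum deg_below_single)
    fix w x assume "w \<in> Poly_Mapping.keys f" "x \<in> Poly_Mapping.keys g"
    with fmax gmax show "?l (w + x) < Suc (nc_deg f + nc_deg g)"
      by (simp add: plus_free_monoid_def less_Suc_eq_le add_mono)
  qed
  from nc_deg_less[OF this nz] have "nc_deg (f * g) \<le> nc_deg f + nc_deg g" by simp
  moreover have "nc_deg f + nc_deg g \<le> nc_deg (f * g)"
  proof -
    have "u + v \<in> Poly_Mapping.keys (f * g)" using uv by (simp add: in_keys_iff)
    then have "?l (u + v) \<le> nc_deg (f * g)" unfolding nc_deg_def by (intro Max_ge) auto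
    then show ?thesis using u v by (simp add: plus_free_monoid_def)
  qed
  ultimately show "nc_deg (f * g) = nc_deg f + nc_deg g" by simp
qed

lemma nc_mult_eq_0_iff:
  fixes f g :: "('g, 'k::field) free_algebra"
  shows "f * g = 0 \<longleftrightarrow> f = 0 \<or> g = 0"
  using nc_deg_mult(1) by fastforce

lemma nonconstant_iff_nc_deg: "nonconstant f \<longleftrightarrow> nc_deg f > 0"
proof -
  have "f = nc_const (Poly_Mapping.lookup f 0)" if d: "nc_deg f = 0"
  proof (rule poly_mapping_eqI)
    fix w
    from d deg_below_nc_deg[of f]
    have "Poly_Mapping.lookup f w = 0" if "letters w \<noteq> []"
      using that by (simp add: deg_below_lookup Suc_le_eq)
    then show "Poly_Mapping.lookup f w = Poly_Mapping.lookup (nc_const (Poly_Mapping.lookup f 0)) w"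
      by (cases w) (auto simp: nc_const_def lookup_single when_def zero_free_monoid_def)
  qed
  moreover have "nc_deg (nc_const c) = 0" for c
    by (simp add: nc_deg_def nc_const_def zero_free_monoid_def)
  ultimately show ?thesis
    unfolding nonconstant_def by (metis gr0I less_irrefl rangeE rangeI)
qed

lemma nc_deg_scale: "c \<noteq> 0 \<Longrightarrow> nc_deg (nc_const c * f) = nc_deg f"
  by (simp add: nc_deg_def lookup_nc_const_mult keys.rep_eq)

section \<open>Irreducible polynomials and the existence of factorizations\<close>

lemma nc_irreducible_scale:
  fixes f :: "('g, 'k::field) free_algebra"
  assumes "c \<noteq> 0" "nc_irreducible f"
  shows "nc_irreducible (nc_const c * f)"
  unfolding nc_irreducible_def
proof (intro conjI notI)
  show "nonconstant (nc_const c * f)"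
    using assms by (simp add: nonconstant_iff_nc_deg nc_deg_scale nc_irreducible_def)
next
  assume "\<exists>p q. nonconstant p \<and> nonconstant q \<and> nc_const c * f = p * q"
  then obtain p q where pq: "nonconstant p" "nonconstant q" "nc_const c * f = p * q" by blast
  have "f = (nc_const (inverse c) * nc_const c) * f"
    using assms(1) by (simp flip: nc_const_mult)
  then have "f = (nc_const (inverse c) * p) * q"
    using pq(3) by (simp add: mult.assoc)
  moreover have "nonconstant (nc_const (inverse c) * p)"
    using pq(1) assms(1) by (simp add: nonconstant_iff_nc_deg nc_deg_scale)
  ultimately show False using assms(2) pq(2) unfolding nc_irreducible_def by blast
qed

lemma factorization_exists:
  fixes f :: "('g, 'k::field) free_algebra"
  assumes "f \<noteq> 0" "nonconstant f"
  shows "\<exists>qs. (\<forall>q\<in>set qs. nc_irreducible q) \<and> f = prod_list qs"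
  using assms
proof (induction "nc_deg f" arbitrary: f rule: less_induct)
  case less
  show ?case
  proof (cases "nc_irreducible f")
    case True
    then show ?thesis by (intro exI[of _ "[f]"]) simp
  next
    case False
    with less.prems obtain p q where pq: "nonconstant p" "nonconstant q" "f = p * q"
      by (auto simp: nc_irreducible_def)
    with less.prems have nz: "p \<noteq> 0" "q \<noteq> 0" by auto
    with pq have "nc_deg p < nc_deg f" "nc_deg q < nc_deg f"
      by (simp_all add: nc_deg_mult nonconstant_iff_nc_deg)
    with less.hyps nz pq obtain ps qs where
      "\<forall>q\<in>set ps. nc_irreducible q" "p = prod_list ps" "\<forall>q\<in>set qs. nc_irreducible q" "q = prod_list qs"
      by metis
    with pq show ?thesis by (intro exI[of _ "ps @ qs"]) auto
  qed
qed

subsection \<open>Division by the shifted variables\<close>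

context
  fixes a :: "'g::finite \<Rightarrow> 'k::field"
begin

definition shifted_var :: "'g \<Rightarrow> ('g, 'k) free_algebra" where
  "shifted_var i = nc_var i - nc_const (a i)"

text \<open>
  \<open>f \<mapsto> left_quot i f\<close> is the linear map with \<open>f = f(a) + (\<Sum>i. (x\<^sub>i - a\<^sub>i) \<cdot> left_quot i f)\<close>; it plays the
  role of cancelling the first letter of a word when \<open>a = 0\<close>.
\<close>

primrec word_left_quot :: "'g \<Rightarrow> 'g list \<Rightarrow> ('g, 'k) free_algebra" where
  "word_left_quot i [] = 0"
| "word_left_quot i (j # w) =
     (if i = j then Poly_Mapping.single (Word w) 1 else 0) + nc_const (a j) * word_left_quot i w"

definition left_quot :: "'g \<Rightarrow> ('g, 'k) free_algebra \<Rightarrow> ('g, 'k) free_algebra" where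
  "left_quot i = lin_ext nc_const (\<lambda>w. word_left_quot i (letters w))"

lemma left_quot_0 [simp]: "left_quot i 0 = 0"
  by (simp add: left_quot_def)

lemma left_quot_add: "left_quot i (f + g) = left_quot i f + left_quot i g"
  by (simp add: left_quot_def scalar_nc.lin_ext_add)

lemma left_quot_const [simp]: "left_quot i (nc_const c) = 0"
  by (simp add: left_quot_def scalar_nc.lin_ext_const zero_free_monoid_def)

lemma left_quot_scale: "left_quot i (nc_const c * f) = nc_const c * left_quot i f"
  by (simp add: left_quot_def scalar_nc.lin_ext_scale)

lemma left_quot_uminus: "left_quot i (- f) = - left_quot i f"
  by (metis add_eq_0_iff left_quot_0 left_quot_add)

lemma left_quot_diff: "left_quot i (f - g) = left_quot i f - left_quot i g"
  by (metis diff_conv_add_uminus left_quot_add left_quot_uminus)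

text \<open>The two summands come from x_j f = (x_j - a_j) f + a_j f.\<close>

lemma left_quot_var:
  "left_quot i (nc_var j * f) = (if i = j then f else 0) + nc_const (a j) * left_quot i f"
proof -
  have "lin_ext nc_const (\<lambda>w. (if i = j then Poly_Mapping.single w 1 else 0)) f = (if i = j then f else 0)"
    by (induction f rule: free_algebra_induct)
      (auto simp: scalar_nc.lin_ext_add scalar_nc.lin_ext_single nc_const_single)
  moreover have "lin_ext nc_const (\<lambda>w. nc_const (a j) * word_left_quot i (letters w)) f
      = nc_const (a j) * left_quot i f"
    by (simp add: left_quot_def lin_ext_def sum_distrib_left nc_const_nc_const_commute)
  ultimately show ?thesis
    by (cases "i = j") (simp_all add: left_quot_def scalar_nc.lin_ext_var scalar_nc.lin_ext_add_fun)
qed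

lemma left_quot_shifted: "left_quot i (shifted_var j * f) = (if i = j then f else 0)"
  by (simp add: shifted_var_def left_diff_distrib left_quot_diff left_quot_var left_quot_scale)

lemma eval_point_shifted [simp]: "eval_point (shifted_var i) a = 0"
  by (simp add: shifted_var_def)

lemma left_quot_sum_shifted: "left_quot i (\<Sum>j\<in>UNIV. shifted_var j * f j) = f i"
proof -
  have "left_quot i (\<Sum>j\<in>A. shifted_var j * f j) = (\<Sum>j\<in>A. if i = j then f j else 0)" for A
    by (induction A rule: infinite_finite_induct) (simp_all add: left_quot_add left_quot_shifted)
  then show ?thesis by simp
qed

lemma left_quot_expansion:
  "f = nc_const (eval_point f a) + (\<Sum>i\<in>UNIV. shifted_var i * left_quot i f)"
proof (induction f rule: nc_poly_induct)
  case (add f g)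
  have "f + g = (nc_const (eval_point f a) + (\<Sum>i\<in>UNIV. shifted_var i * left_quot i f))
      + (nc_const (eval_point g a) + (\<Sum>i\<in>UNIV. shifted_var i * left_quot i g))"
    by (rule arg_cong2[where f = "(+)", OF add])
  also have "\<dots> = nc_const (eval_point (f + g) a) + (\<Sum>i\<in>UNIV. shifted_var i * left_quot i (f + g))"
    by (simp add: nc_const_add left_quot_add distrib_left sum.distrib)
  finally show ?case .
next
  case (var j f)
  have "(\<Sum>i\<in>UNIV. shifted_var i * left_quot i (nc_var j * f))
      = (\<Sum>i\<in>UNIV. (if i = j then shifted_var i * f else 0)) + nc_const (a j) * (\<Sum>i\<in>UNIV. shifted_var i * left_quot i f)"
    by (simp add: left_quot_var distrib_left sum.distrib sum_distrib_left nc_const_left_commute[of "shifted_var _"]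
        if_distrib[of "\<lambda>z. _ * z"] cong: if_cong)
  also have "\<dots> = shifted_var j * f + nc_const (a j) * (f - nc_const (eval_point f a))"
  proof -
    have "(\<Sum>i\<in>UNIV. shifted_var i * left_quot i f) = f - nc_const (eval_point f a)"
      by (subst eq_diff_eq, subst add.commute, rule var[symmetric])
    then show ?thesis by (simp only: sum.delta finite UNIV_I if_True)
  qed
  finally show ?case
    by (simp add: nc_const_mult shifted_var_def algebra_simps)
qed simp

lemma sum_left_quot: "(\<Sum>i\<in>UNIV. shifted_var i * left_quot i f) = f - nc_const (eval_point f a)"
  by (subst eq_diff_eq, subst add.commute, rule left_quot_expansion[symmetric])

lemma left_quot_eq_0D:
  assumes "eval_point f a = 0" "\<And>i. left_quot i f = 0"
  shows "f = 0"
  using sum_left_quot[of f] assms by simp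

text \<open>Dividing a word leaves only strictly shorter words. This loss of one degree drives the
  later inductions on the degree bound.\<close>

lemma left_quot_deg_below:
  assumes "f \<in> deg_below (Suc d)"
  shows "left_quot i f \<in> deg_below d"
proof -
  have word: "word_left_quot i w \<in> deg_below (length w)" for w
  proof (induction w)
    case (Cons j w)
    have "word_left_quot i w \<in> deg_below (Suc (length w))"
      using Cons deg_below_mono[of "length w" "Suc (length w)"] by auto
    then show ?case
      by (auto intro!: deg_below_add deg_below_scale deg_below_single)
  qed simp
  show ?thesis
    unfolding left_quot_def lin_ext_def
  proof (intro deg_below_sum deg_below_scale)
    fix w assume "w \<in> Poly_Mapping.keys f"
    with assms have "length (letters w) \<le> d" by (auto simp: deg_below_def)
    with word[of "letters w"] deg_below_mono show "word_left_quot i (letters w) \<in> deg_below d" by blast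
  qed
qed

text \<open>
  No general theory of free ideal rings is needed: an element of least degree in \<open>J\<close> cannot vanish
  at \<open>a\<close>, since dividing it by a shifted variable would lower the degree, and then it generates \<open>J\<close>.
\<close>

lemma left_ideal_principal:
  fixes J :: "('g, 'k) free_algebra set"
  assumes add: "\<And>f g. f \<in> J \<Longrightarrow> g \<in> J \<Longrightarrow> f + g \<in> J"
    and mult: "\<And>r f. f \<in> J \<Longrightarrow> r * f \<in> J"
    and quot: "\<And>f i. f \<in> J \<Longrightarrow> eval_point f a = 0 \<Longrightarrow> left_quot i f \<in> J"
    and q: "q \<in> J" "q \<noteq> 0"
  obtains g where "J = range (\<lambda>r. r * g)"
proof -
  define m where "m = (LEAST n. \<exists>g\<in>J. g \<noteq> 0 \<and> nc_deg g = n)"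
  have "\<exists>g\<in>J. g \<noteq> 0 \<and> nc_deg g = m"
    unfolding m_def by (rule LeastI[of _ "nc_deg q"]) (use q in blast)
  then obtain g where g: "g \<in> J" "g \<noteq> 0" "nc_deg g = m" by blast
  have small: "f = 0" if "f \<in> J" "f \<in> deg_below m" for f
  proof (rule ccontr)
    assume "f \<noteq> 0"
    with that have "nc_deg f < m" by (simp add: nc_deg_less)
    moreover have "m \<le> nc_deg f"
      unfolding m_def using that(1) \<open>f \<noteq> 0\<close> by (intro Least_le) blast
    ultimately show False by simp
  qed
  have g_deg: "g \<in> deg_below (Suc m)" using deg_below_nc_deg[of g] g(3) by simp
  have ga: "eval_point g a \<noteq> 0"
  proof
    assume 0: "eval_point g a = 0"
    then have "left_quot i g = 0" for i
      using quot[OF g(1)] left_quot_deg_below[OF g_deg] small by blast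
    with 0 left_quot_eq_0D g(2) show False by blast
  qed
  have gen: "f \<in> range (\<lambda>r. r * g)" if "f \<in> J" "f \<in> deg_below n" for f n
    using that
  proof (induction n arbitrary: f)
    case 0
    then have "f = 0 * g" by simp
    then show ?case by blast
  next
    case (Suc n)
    show ?case
    proof (cases "n < m")
      case True
      with Suc.prems have "f \<in> deg_below m" using deg_below_mono[of "Suc n" m] by auto
      with Suc.prems(1) small have "f = 0 * g" by auto
      then show ?thesis by blast
    next
      case False
      \<comment> \<open>This \<open>c\<close> makes \<open>f'\<close> vanish at \<open>a\<close>, so
        the quotients of \<open>f'\<close> stay in \<open>J\<close> with a smaller degree bound, and
        the expansion of \<open>f'\<close> reassembles a left multiple of \<open>g\<close>.\<close>
      define c where "c = eval_point f a / eval_point g a"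
      define f' where "f' = f + nc_const (- c) * g"
      have f': "f' \<in> J" "eval_point f' a = 0"
        using Suc.prems(1) g(1) ga by (auto simp: f'_def c_def intro!: add mult)
      have "g \<in> deg_below (Suc n)" using g_deg False deg_below_mono[of "Suc m" "Suc n"] by auto
      with Suc.prems(2) have "f' \<in> deg_below (Suc n)"
        by (simp add: f'_def deg_below_add deg_below_scale)
      with f' Suc.IH quot left_quot_deg_below have "\<exists>r. left_quot i f' = r * g" for i
        by blast
      then obtain r where r: "\<And>i. left_quot i f' = r i * g" by metis
      have "f' = (\<Sum>i\<in>UNIV. shifted_var i * r i) * g"
        using sum_left_quot[of f'] f'(2) r by (simp add: sum_distrib_right mult.assoc)
      then have "f = (nc_const c + (\<Sum>i\<in>UNIV. shifted_var i * r i)) * g"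
        by (simp add: f'_def nc_const_uminus algebra_simps)
      then show ?thesis by blast
    qed
  qed
  have "J = range (\<lambda>r. r * g)"
    using gen[OF _ deg_below_nc_deg] mult[OF g(1)] by auto
  then show ?thesis by (rule that)
qed

text \<open>The generator of \<open>J\<close> is a right divisor of the irreducible
  \<open>q\<close>, so it is either a nonzero constant or a scalar multiple of
  \<open>q\<close>.\<close>

lemma left_ideal_irreducible:
  fixes J :: "('g, 'k) free_algebra set"
  assumes add: "\<And>f g. f \<in> J \<Longrightarrow> g \<in> J \<Longrightarrow> f + g \<in> J"
    and mult: "\<And>r f. f \<in> J \<Longrightarrow> r * f \<in> J"
    and quot: "\<And>f i. f \<in> J \<Longrightarrow> eval_point f a = 0 \<Longrightarrow> left_quot i f \<in> J"
    and q: "q \<in> J" "nc_irreducible q"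
  shows "1 \<in> J \<or> J = range (\<lambda>r. r * q)"
proof -
  have "q \<noteq> 0" using q(2) unfolding nc_irreducible_def nonconstant_def
    by (metis nc_const_0 rangeI)
  then obtain g where g: "J = range (\<lambda>r. r * g)"
    using left_ideal_principal[OF add mult quot q(1)] by blast
  with q(1) obtain r where r: "q = r * g" by blast
  with q(2) have "\<not> nonconstant r \<or> \<not> nonconstant g" by (auto simp: nc_irreducible_def)
  then show ?thesis
  proof
    assume "\<not> nonconstant g"
    then obtain c where c: "g = nc_const c" by (auto simp: nonconstant_def)
    with r \<open>q \<noteq> 0\<close> have "c \<noteq> 0" by auto
    then have "1 = nc_const (inverse c) * g" by (simp add: c flip: nc_const_mult)
    with g show ?thesis by blast
  next
    assume "\<not> nonconstant r"
    then obtain c where c: "r = nc_const c" by (auto simp: nonconstant_def)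
    with r \<open>q \<noteq> 0\<close> have "c \<noteq> 0" by auto
    then have "g = nc_const (inverse c) * q"
      by (simp add: r c flip: nc_const_mult mult.assoc)
    then have "x * g \<in> range (\<lambda>r. r * q)" for x
      by (metis mult.assoc rangeI)
    with g mult[OF q(1)] show ?thesis by auto
  qed
qed

subsection \<open>The quotient module of a polynomial\<close>

text \<open>
  The left module \<open>M\<close> of all polynomials modulo the left multiples of \<open>p\<close>, where \<open>p(a) \<noteq> 0\<close>, is the
  direct sum of the \<open>(x\<^sub>i - a\<^sub>i)M\<close>. The map \<open>qshift p i\<close> induces on \<open>M\<close> the coordinate map for the
  index \<open>i\<close>, and preserves the polynomials of degree less than that of \<open>p\<close>.
\<close>

definition qshift :: "('g, 'k) free_algebra \<Rightarrow> 'g \<Rightarrow> ('g, 'k) free_algebra \<Rightarrow> ('g, 'k) free_algebra" where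
  "qshift p i f = left_quot i (f - nc_const (eval_point f a / eval_point p a) * p)"

lemma qshift_0 [simp]: "qshift p i 0 = 0"
  by (simp add: qshift_def)

lemma qshift_add: "qshift p i (f + g) = qshift p i f + qshift p i g"
  by (simp add: qshift_def left_quot_add left_quot_diff nc_const_add add_divide_distrib algebra_simps)

lemma qshift_scale: "qshift p i (nc_const c * f) = nc_const c * qshift p i f"
proof -
  have "nc_const c * f - nc_const (c * eval_point f a / eval_point p a) * p
     = nc_const c * (f - nc_const (eval_point f a / eval_point p a) * p)"
    by (simp add: right_diff_distrib nc_const_mult mult.assoc flip: times_divide_eq_right)
  then show ?thesis by (simp add: qshift_def eval_point_scale left_quot_scale)
qed

lemma qshift_sum: "qshift p i (sum f A) = (\<Sum>x\<in>A. qshift p i (f x))"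
  by (induction A rule: infinite_finite_induct) (simp_all add: qshift_add)

lemma qshift_shifted: "qshift p i (shifted_var j * f) = (if i = j then f else 0)"
  by (simp add: qshift_def left_quot_shifted)

lemma qshift_eval_0: "eval_point f a = 0 \<Longrightarrow> qshift p i f = left_quot i f"
  by (simp add: qshift_def)

text \<open>Since \<open>left_quot\<close> vanishes on 1, \<open>qshift p i 1\<close> is the pure
  correction term; for general \<open>f\<close> this term is scaled by f(a).\<close>

lemma qshift_left_quot: "qshift p i f = left_quot i f + nc_const (eval_point f a) * qshift p i 1"
proof -
  have "qshift p i 1 = - (nc_const (1 / eval_point p a) * left_quot i p)"
    using left_quot_const[of i 1] by (simp add: qshift_def left_quot_diff left_quot_scale)
  then show ?thesis
    by (simp add: qshift_def left_quot_diff left_quot_scale mult.assoc[symmetric] nc_const_mult[symmetric])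
qed

lemma qshift_deg_below:
  assumes "p \<in> deg_below (Suc d)" "f \<in> deg_below d"
  shows "qshift p i f \<in> deg_below d"
  unfolding qshift_def
proof (intro left_quot_deg_below deg_below_diff deg_below_scale assms(1))
  show "f \<in> deg_below (Suc d)" using assms(2) deg_below_mono[of d "Suc d"] by auto
qed

text \<open>The quotient of (u p)(a) by p(a) is u(a), so the correction replaces \<open>u\<close> by
  u - u(a), a combination of the shifted variables.\<close>

lemma qshift_mult:
  assumes "eval_point p a \<noteq> 0"
  shows "qshift p i (u * p) = left_quot i u * p"
proof -
  have "u * p - nc_const (eval_point (u * p) a / eval_point p a) * p = (u - nc_const (eval_point u a)) * p"
    using assms by (simp add: left_diff_distrib)
  also have "u - nc_const (eval_point u a) = (\<Sum>i\<in>UNIV. shifted_var i * left_quot i u)"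
    by (rule sum_left_quot[symmetric])
  finally have "qshift p i (u * p) = left_quot i (\<Sum>j\<in>UNIV. shifted_var j * (left_quot j u * p))"
    unfolding qshift_def by (simp add: sum_distrib_right mult.assoc)
  then show ?thesis by (simp add: left_quot_sum_shifted)
qed

lemma qshift_expansion:
  assumes "eval_point p a \<noteq> 0"
  shows "f = (\<Sum>i\<in>UNIV. shifted_var i * qshift p i f) + nc_const (eval_point f a / eval_point p a) * p"
proof -
  let ?f = "f - nc_const (eval_point f a / eval_point p a) * p"
  have "?f = (\<Sum>i\<in>UNIV. shifted_var i * qshift p i f)"
    unfolding qshift_def using sum_left_quot[of ?f] assms by simp
  then show ?thesis by (metis diff_add_cancel)
qed

text \<open>The coordinate maps thus descend to the quotient module, where only zero has all
  coordinates zero.\<close>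

lemma qshift_multiple_iff:
  assumes p: "eval_point p a \<noteq> 0"
  shows "f \<in> range (\<lambda>r. r * p) \<longleftrightarrow> (\<forall>i. qshift p i f \<in> range (\<lambda>r. r * p))"
proof
  assume "f \<in> range (\<lambda>r. r * p)"
  then show "\<forall>i. qshift p i f \<in> range (\<lambda>r. r * p)" using qshift_mult[OF p] by blast
next
  assume "\<forall>i. qshift p i f \<in> range (\<lambda>r. r * p)"
  then have "\<forall>i. \<exists>r. qshift p i f = r * p" by blast
  then obtain r where r: "\<And>i. qshift p i f = r i * p" by metis
  have "f = ((\<Sum>i\<in>UNIV. shifted_var i * r i) + nc_const (eval_point f a / eval_point p a)) * p"
    using qshift_expansion[OF p, of f] by (simp add: r distrib_right sum_distrib_right mult.assoc)
  then show "f \<in> range (\<lambda>r. r * p)" by blast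
qed

text \<open>Hence \<open>V\<^sub>p\<close>, as a space of polynomials, embeds into the quotient
  module.\<close>

lemma multiple_deg_below:
  fixes p :: "('g, 'k) free_algebra"
  assumes "f \<in> range (\<lambda>r. r * p)" "f \<in> deg_below (nc_deg p)"
  shows "f = 0"
proof (rule ccontr)
  assume "f \<noteq> 0"
  from assms(1) obtain r where r: "f = r * p" by blast
  with \<open>f \<noteq> 0\<close> have "r \<noteq> 0" "p \<noteq> 0" by auto
  with r have "nc_deg p \<le> nc_deg f" by (simp add: nc_deg_mult)
  with nc_deg_less[OF assms(2) \<open>f \<noteq> 0\<close>] show False by simp
qed

text \<open>Each variable acts by its coordinate map. As \<open>foldr\<close> applies the last
  letter first, products act as compositions; on \<open>deg_below (nc_deg p)\<close> this is the
  module \<open>V\<^sub>p\<close>.\<close>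

definition qact :: "('g, 'k) free_algebra \<Rightarrow> ('g, 'k) free_algebra \<Rightarrow> ('g, 'k) free_algebra \<Rightarrow> ('g, 'k) free_algebra" where
  "qact p h f = lin_ext nc_const (\<lambda>w. foldr (qshift p) (letters w) f) h"

lemma qact_0_left [simp]: "qact p 0 f = 0"
  by (simp add: qact_def)

lemma qact_add_left: "qact p (g + h) f = qact p g f + qact p h f"
  by (simp add: qact_def scalar_nc.lin_ext_add)

lemma qact_const: "qact p (nc_const c) f = nc_const c * f"
  by (simp add: qact_def scalar_nc.lin_ext_const zero_free_monoid_def)

lemma qact_1 [simp]: "qact p 1 f = f"
  using qact_const[of p 1 f] by simp

lemma qact_scale_left: "qact p (nc_const c * h) f = nc_const c * qact p h f"
  by (simp add: qact_def scalar_nc.lin_ext_scale)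

lemma qact_var_mult: "qact p (nc_var i * h) f = qshift p i (qact p h f)"
  by (simp add: qact_def scalar_nc.lin_ext_var) (simp add: lin_ext_def qshift_sum qshift_scale)

lemma qact_mult: "qact p (g * h) f = qact p g (qact p h f)"
  by (induction g rule: nc_poly_induct)
    (simp_all add: qact_add_left qact_const qact_scale_left qact_var_mult distrib_right mult.assoc)

lemma qact_var: "qact p (nc_var i) f = qshift p i f"
  using qact_var_mult[of p i 1 f] by simp

lemma qact_add: "qact p h (f + g) = qact p h f + qact p h g"
  by (induction h rule: nc_poly_induct)
    (simp_all add: qact_add_left qact_const qact_var_mult qshift_add distrib_left algebra_simps)

lemma qact_scale: "qact p h (nc_const c * f) = nc_const c * qact p h f"
  by (induction h rule: nc_poly_induct)
    (simp_all add: qact_add_left qact_const qact_var_mult qshift_scale distrib_left nc_const_nc_const_commute)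

lemma qact_0 [simp]: "qact p h 0 = 0"
  using qact_scale[of p h 0 0] by simp

lemma qact_sum: "qact p h (sum f A) = (\<Sum>x\<in>A. qact p h (f x))"
  by (induction A rule: infinite_finite_induct) (simp_all add: qact_add)

lemma qact_deg_below:
  assumes "p \<in> deg_below (Suc d)" "f \<in> deg_below d"
  shows "qact p h f \<in> deg_below d"
  by (induction h rule: nc_poly_induct)
    (simp_all add: qact_add_left qact_const qact_var_mult assms deg_below_add deg_below_scale qshift_deg_below[OF assms(1)])

end

subsection \<open>Simple submodules\<close>

lemma finite_words: "finite {w :: 'g::finite free_monoid. length (letters w) < d}"
proof (rule finite_imageD[where f = letters])
  show "finite (letters ` {w :: 'g free_monoid. length (letters w) < d})"
    by (rule finite_subset[OF _ finite_lists_length_le[of UNIV d]]) auto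
qed (auto intro: inj_onI free_monoid.expand)

lemma vector_space_nc: "vector_space (\<lambda>c f. nc_const c * f :: ('g, 'k::field) free_algebra)"
  by unfold_locales
    (simp_all add: nc_const_add nc_const_mult distrib_left distrib_right mult.assoc)

text \<open>Take a nonzero \<open>s\<close> whose cyclic submodule has least dimension. Any nonzero
  vector in it generates a submodule of no smaller dimension, hence the same one, and can be moved
  back to \<open>s\<close>: the submodule is simple.\<close>

lemma simple_vector_exists:
  fixes p :: "('g::finite, 'k::field) free_algebra"
  assumes d: "nc_deg p > 0"
  obtains s where "s \<in> deg_below (nc_deg p)" "s \<noteq> 0"
    "\<And>h. qact a p h s \<noteq> 0 \<Longrightarrow> \<exists>g. qact a p (g * h) s = s"
proof -
  interpret vs: vector_space "\<lambda>c f. nc_const c * f :: ('g, 'k) free_algebra"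
    by (rule vector_space_nc)
  define orb where "orb s = range (\<lambda>h. qact a p h s)" for s
  have orb_sub: "vs.subspace (orb s)" for s
  proof (rule vs.subspaceI)
    show "0 \<in> orb s" unfolding orb_def by (metis qact_0_left rangeI)
    show "x + y \<in> orb s" if "x \<in> orb s" "y \<in> orb s" for x y
      using that unfolding orb_def by (auto simp flip: qact_add_left)
    show "nc_const c * x \<in> orb s" if "x \<in> orb s" for c x
      using that unfolding orb_def by (auto simp flip: qact_scale_left)
  qed
  define W where "W = (\<lambda>w. Poly_Mapping.single w (1::'k)) ` {w :: 'g free_monoid. length (letters w) < nc_deg p}"
  have finW: "finite W" unfolding W_def by (intro finite_imageI finite_words)
  have spanW: "deg_below (nc_deg p) \<subseteq> vs.span W"
  proof
    fix f :: "('g, 'k) free_algebra"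
    assume f: "f \<in> deg_below (nc_deg p)"
    have "f = (\<Sum>w\<in>Poly_Mapping.keys f. nc_const (Poly_Mapping.lookup f w) * Poly_Mapping.single w 1)"
      by (simp add: nc_const_single sum_single_lookup)
    also have "\<dots> \<in> vs.span W"
      using f by (intro vs.span_sum vs.span_scale vs.span_base) (auto simp: W_def deg_below_def)
    finally show "f \<in> vs.span W" .
  qed
  let ?P = "\<lambda>s. s \<in> deg_below (nc_deg p) \<and> s \<noteq> 0"
  have "?P 1"
    using deg_below_const[of 1 "nc_deg p - 1"] d by simp
  then obtain s where s: "?P s" and min: "\<And>t. ?P t \<Longrightarrow> vs.dim (orb s) \<le> vs.dim (orb t)"
    using ex_has_least_nat[of ?P 1 "\<lambda>s. vs.dim (orb s)"] by blast
  show ?thesis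
  proof (rule that[of s])
    fix h assume h: "qact a p h s \<noteq> 0"
    let ?t = "qact a p h s"
    have t: "?P ?t" using h s by (auto intro: qact_deg_below deg_below_nc_deg)
    have sub: "orb ?t \<subseteq> orb s" unfolding orb_def by (auto simp flip: qact_mult)
    \<comment> \<open>The orbit lies in a finite-dimensional space, so an inclusion without loss of
      dimension is an equality.\<close>
    have orbW: "orb s \<subseteq> vs.span W"
      using s spanW unfolding orb_def by (auto intro!: qact_deg_below deg_below_nc_deg)
    obtain B where B: "B \<subseteq> orb ?t" "vs.independent B" "orb ?t \<subseteq> vs.span B"
      using vs.maximal_independent_subset by blast
    with sub obtain C where C: "B \<subseteq> C" "C \<subseteq> orb s" "vs.independent C" "orb s \<subseteq> vs.span C"
      using vs.maximal_independent_subset_extend[OF subset_trans[OF B(1) sub] B(2)] by metis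
    have finC: "finite C"
      using vs.independent_span_bound[OF finW C(3)] C(2) orbW by auto
    have "card C = vs.dim (orb s)" "card B = vs.dim (orb ?t)"
      using vs.basis_card_eq_dim B C by blast+
    with min[OF t] have "card C \<le> card B" by simp
    with finC C(1) have "B = C" by (meson card_seteq)
    with B(1) C(4) have "orb s \<subseteq> vs.span (orb ?t)" using vs.span_mono by blast
    then have "orb s \<subseteq> orb ?t" using vs.span_eq_iff orb_sub by blast
    moreover have "s \<in> orb s" unfolding orb_def by (metis qact_1 rangeI)
    ultimately have "s \<in> orb ?t" by blast
    then show "\<exists>g. qact a p (g * h) s = s"
      unfolding orb_def qact_mult by (metis imageE)
  qed (use s in auto)
qed

text \<open>
  If no polynomial annihilating all of the \<open>t\<close> moves \<open>s\<close>, adding the \<open>t\<close> one at a time yields a left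
  ideal \<open>L\<close> for which \<open>h \<cdot> t \<mapsto> h \<cdot> s\<close> is a well-defined nonzero map of modules on \<open>L \<cdot> t\<close>.
\<close>

lemma annihilator_dichotomy:
  fixes p :: "('g::finite, 'k::field) free_algebra"
  assumes s: "\<exists>h. Poly_Mapping.lookup h 0 = 0 \<and> qact a p h s \<noteq> 0"
  obtains
    (annihilator) h where "Poly_Mapping.lookup h 0 = 0" "qact a p h s \<noteq> 0"
      "\<And>q t. (q, t) \<in> set ts \<Longrightarrow> qact a q h t = 0"
  | (morphism) q t L where "(q, t) \<in> set ts" "\<And>g h. h \<in> L \<Longrightarrow> g * h \<in> L"
      "\<And>g h. g \<in> L \<Longrightarrow> h \<in> L \<Longrightarrow> g + h \<in> L" "\<exists>h\<in>L. qact a p h s \<noteq> 0"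
      "\<And>h. h \<in> L \<Longrightarrow> qact a q h t = 0 \<Longrightarrow> qact a p h s = 0"
proof -
  have "(\<exists>h. Poly_Mapping.lookup h 0 = 0 \<and> qact a p h s \<noteq> 0 \<and> (\<forall>(q, t)\<in>set ts. qact a q h t = 0)) \<or>
    (\<exists>q t L. (q, t) \<in> set ts \<and> (\<forall>g. \<forall>h\<in>L. g * h \<in> L) \<and> (\<forall>g\<in>L. \<forall>h\<in>L. g + h \<in> L) \<and>
       (\<exists>h\<in>L. qact a p h s \<noteq> 0) \<and> (\<forall>h\<in>L. qact a q h t = 0 \<longrightarrow> qact a p h s = 0))"
    (is "?A ts \<or> ?B ts")
  proof (induction ts)
    case Nil
    then show ?case using s by simp
  next
    case (Cons x ts)
    obtain q t where x: "x = (q, t)" by (cases x)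
    show ?case
    proof (rule ccontr)
      assume not: "\<not> (?A (x # ts) \<or> ?B (x # ts))"
      \<comment> \<open>\<open>L\<close> kills the vectors already treated. An \<open>h\<close> in
        \<open>L\<close> that kills \<open>t\<close> but not \<open>s\<close> would annihilate the
        longer list; its absence makes the map on \<open>L\<close> well defined.\<close>
      define L where "L = {h. Poly_Mapping.lookup h 0 = 0 \<and> (\<forall>(q, t)\<in>set ts. qact a q h t = 0)}"
      have "\<not> ?B ts"
      proof
        assume "?B ts"
        then have "?B (x # ts)" by (elim exE conjE, intro exI conjI) (rule list.set_intros(2))
        with not show False by blast
      qed
      with Cons have "?A ts" by blast
      then have "\<exists>h\<in>L. qact a p h s \<noteq> 0" unfolding L_def by blast
      moreover have "\<forall>g. \<forall>h\<in>L. g * h \<in> L" by (auto simp: L_def lookup_mult_0 qact_mult)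
      moreover have "\<forall>g\<in>L. \<forall>h\<in>L. g + h \<in> L" by (fastforce simp: L_def lookup_add qact_add_left)
      moreover have "\<forall>h\<in>L. qact a q h t = 0 \<longrightarrow> qact a p h s = 0"
      proof (intro ballI impI, rule ccontr)
        fix h assume "h \<in> L" "qact a q h t = 0" "qact a p h s \<noteq> 0"
        then have "?A (x # ts)" by (intro exI[of _ h]) (simp add: L_def x)
        with not show False by blast
      qed
      moreover have "(q, t) \<in> set (x # ts)" by (simp add: x)
      ultimately have "?B (x # ts)" by (intro exI[of _ q] exI[of _ t] exI[of _ L] conjI)
      with not show False by blast
    qed
  qed
  then show ?thesis
  proof (elim disjE exE conjE)
    fix h assume "Poly_Mapping.lookup h 0 = 0" "qact a p h s \<noteq> 0" "\<forall>(q, t)\<in>set ts. qact a q h t = 0"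
    then show ?thesis by (intro annihilator[of h]) auto
  next
    fix q t L assume "(q, t) \<in> set ts" "\<forall>g. \<forall>h\<in>L. g * h \<in> L" "\<forall>g\<in>L. \<forall>h\<in>L. g + h \<in> L"
      "\<exists>h\<in>L. qact a p h s \<noteq> 0" "\<forall>h\<in>L. qact a q h t = 0 \<longrightarrow> qact a p h s = 0"
    then show ?thesis by (intro morphism[of q t L]) auto
  qed
qed

subsection \<open>Stable association from an isomorphism of quotient modules\<close>

definition mat2 :: "'a \<Rightarrow> 'a \<Rightarrow> 'a \<Rightarrow> 'a \<Rightarrow> 'a mat" where
  "mat2 x y z w = mat 2 2 (\<lambda>(i, j). if i = 0 then if j = 0 then x else y else if j = 0 then z else w)"

lemma mat2_carrier [simp]: "mat2 x y z w \<in> carrier_mat 2 2"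
  by (simp add: mat2_def)

lemma mat2_mult:
  fixes x y z w :: "'a::semiring_0"
  shows "mat2 x y z w * mat2 x' y' z' w'
    = mat2 (x * x' + y * z') (x * y' + y * w') (z * x' + w * z') (z * y' + w * w')"
  by (rule eq_matI) (auto simp: mat2_def scalar_prod_def numeral_2_eq_2)

lemma mat2_one: "1\<^sub>m 2 = mat2 1 0 0 1"
  by (rule eq_matI) (auto simp: mat2_def)

lemma invertible_mat2I:
  assumes "mat2 x y z w * mat2 x' y' z' w' = mat2 1 0 0 1" "mat2 x' y' z' w' * mat2 x y z w = mat2 1 0 0 1"
  shows "invertible_mat (mat2 x y z w)"
  unfolding invertible_mat_def inverts_mat_def
  using assms by (auto simp: mat2_one[symmetric] mat2_def intro!: exI[of _ "mat2 x' y' z' w'"])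

lemma diag_block_mat_of_poly: "diag_block_mat [mat_of_poly p, 1\<^sub>m 1] = mat2 p 0 0 1"
  by (rule eq_matI) (auto simp: mat2_def mat_of_poly_def)

text \<open>Right multiplications by \<open>u\<close> and \<open>v\<close> are mutually inverse
  isomorphisms between the left modules modulo \<open>p\<close> and modulo \<open>q\<close>; the
  invertible matrices are assembled from these data.\<close>

lemma stably_associatedI:
  fixes p q :: "('g, 'k::field) free_algebra"
  assumes nz: "p \<noteq> 0" "q \<noteq> 0"
    and pu: "p * u = u' * q" and qv: "q * v = v' * p"
    and uv: "u * v = 1 + c * p" and vu: "v * u = 1 + d * q"
  shows "stably_associated (mat_of_poly p) (mat_of_poly q)"
proof -
  let ?P = "mat2 u' p (- d) (- v)" and ?Q = "mat2 v 1 (1 - u * v) (- u)"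
  have uv': "c * p = u * v - 1" and vu': "d * q = v * u - 1"
    using uv vu by simp_all
  have cancel_p: "x = y" if "x * p = y * p" for x y
  proof -
    from that have "(x - y) * p = 0" by (simp add: left_diff_distrib)
    with nz nc_mult_eq_0_iff[of "x - y" p] show ?thesis by simp
  qed
  have cancel_q: "x = y" if "x * q = y * q" for x y
  proof -
    from that have "(x - y) * q = 0" by (simp add: left_diff_distrib)
    with nz nc_mult_eq_0_iff[of "x - y" q] show ?thesis by simp
  qed
  \<comment> \<open>The identities \<open>i1\<close> to \<open>i4\<close> are needed for the inverse
    of \<open>?P\<close>. There are no zero divisors, so each may be checked after right
    multiplication by \<open>p\<close> or \<open>q\<close>, where the hypotheses apply.\<close>
  have i1: "u' * v' - p * c = 1"
  proof (rule cancel_p)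
    have "(u' * v' - p * c) * p = u' * (q * v) - p * (c * p)" by (simp add: left_diff_distrib mult.assoc qv)
    also have "\<dots> = (p * u) * v - p * (u * v - 1)" by (simp only: pu uv' mult.assoc)
    also have "\<dots> = 1 * p" by (simp add: algebra_simps)
    finally show "(u' * v' - p * c) * p = 1 * p" .
  qed
  have i2: "d * v' = v * c"
  proof (rule cancel_p)
    have "d * v' * p = (d * q) * v" by (simp add: mult.assoc qv)
    also have "\<dots> = v * (c * p)" by (simp add: uv' vu' algebra_simps)
    finally show "d * v' * p = v * c * p" by (simp add: mult.assoc)
  qed
  have i3: "v' * u' - q * d = 1"
  proof (rule cancel_q)
    have "(v' * u' - q * d) * q = v' * (p * u) - q * (d * q)" by (simp add: left_diff_distrib mult.assoc pu)
    also have "\<dots> = (q * v) * u - q * (v * u - 1)" by (simp only: qv vu' mult.assoc)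
    also have "\<dots> = 1 * q" by (simp add: algebra_simps)
    finally show "(v' * u' - q * d) * q = 1 * q" .
  qed
  have i4: "c * u' = u * d"
  proof (rule cancel_q)
    have "c * u' * q = (c * p) * u" by (simp add: mult.assoc pu)
    also have "\<dots> = u * (d * q)" by (simp add: uv' vu' algebra_simps)
    finally show "c * u' * q = u * d * q" by (simp add: mult.assoc)
  qed
  have P: "invertible_mat ?P"
    by (rule invertible_mat2I[of _ _ _ _ v' q "- c" "- u"])
      (use pu qv uv vu i1 i2 i3 i4 in \<open>simp_all add: mat2_mult\<close>)
  have Q: "invertible_mat ?Q"
    by (rule invertible_mat2I[of _ _ _ _ u 1 "1 - v * u" "- v"])
      (simp_all add: mat2_mult algebra_simps)
  have "?P * mat2 q 0 0 1 * ?Q = mat2 p 0 0 1"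
  proof -
    have "u' * q * v + p * (1 - u * v) = p"
      by (simp add: right_diff_distrib mult.assoc flip: pu)
    moreover have "- (d * q * v) + - (v * (1 - u * v)) = 0"
      by (simp add: vu' algebra_simps)
    ultimately show ?thesis
      using vu by (simp add: mat2_mult pu)
  qed
  then show ?thesis
    unfolding stably_associated_def
    apply (intro conjI)
      apply (simp_all add: mat_of_poly_def)[2]
    apply (rule exI[of _ 1], rule exI[of _ 1], rule exI[of _ ?P], rule exI[of _ ?Q])
    unfolding diag_block_mat_of_poly
    using P Q by (simp add: mat_of_poly_def numeral_2_eq_2[symmetric])
qed

text \<open>
  The map \<open>h \<cdot> t \<mapsto> h \<cdot> s\<close> is extended to the submodule generated by \<open>L \<cdot> t\<close>: a pair belongs to the graph
  \<open>G\<close> of the extension once enough coordinate maps send it to the graph of the given map.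
\<close>

lemma stably_associated_of_morphism:
  fixes p q :: "('g::finite, 'k::field) free_algebra"
  assumes irr: "nc_irreducible p" "nc_irreducible q"
    and pa: "eval_point p a \<noteq> 0" and qa: "eval_point q a \<noteq> 0"
    and s: "s \<in> deg_below (nc_deg p)" and t: "t \<in> deg_below (nc_deg q)"
    and L_mult: "\<And>g h. h \<in> L \<Longrightarrow> g * h \<in> L" and L_add: "\<And>g h. g \<in> L \<Longrightarrow> h \<in> L \<Longrightarrow> g + h \<in> L"
    and nz: "h\<^sub>0 \<in> L" "qact a p h\<^sub>0 s \<noteq> 0"
    and ker: "\<And>h. h \<in> L \<Longrightarrow> qact a q h t = 0 \<Longrightarrow> qact a p h s = 0"
  shows "stably_associated (mat_of_poly p) (mat_of_poly q)"
proof -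
  define \<Phi> where "\<Phi> S = {(x, y). \<forall>i. (qshift a q i x, qshift a p i y) \<in> S}"
    for S :: "(('g, 'k) free_algebra \<times> ('g, 'k) free_algebra) set"
  define G\<^sub>0 where "G\<^sub>0 = (\<lambda>h. (qact a q h t, qact a p h s)) ` L"
  define Gn where "Gn n = (\<Phi> ^^ n) G\<^sub>0" for n
  define G where "G = (\<Union>n. Gn n)"
  have Gn_0: "Gn 0 = G\<^sub>0" and Gn_Suc: "Gn (Suc n) = \<Phi> (Gn n)" for n by (simp_all add: Gn_def)
  have Gn_SucI: "(x, y) \<in> Gn (Suc n)" if "\<And>i. (qshift a q i x, qshift a p i y) \<in> Gn n" for x y n
    using that by (auto simp: Gn_Suc \<Phi>_def)
  have Gn_SucD: "(qshift a q i x, qshift a p i y) \<in> Gn n" if "(x, y) \<in> Gn (Suc n)" for i x y n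
    using that by (auto simp: Gn_Suc \<Phi>_def)
  \<comment> \<open>\<open>L\<close> is a left ideal, so \<open>G\<^sub>0\<close> is stable under
    the coordinate maps; this is what makes the stages increase.\<close>
  have G0_shift: "(qshift a q i x, qshift a p i y) \<in> G\<^sub>0" if "(x, y) \<in> G\<^sub>0" for i x y
    using that L_mult[of _ "nc_var i"] unfolding G\<^sub>0_def by (auto simp flip: qact_var_mult)
  have Gn_step: "Gn n \<subseteq> Gn (Suc n)" for n
  proof (induction n)
    case 0
    then show ?case using G0_shift by (auto simp: Gn_0 intro!: Gn_SucI)
  next
    case (Suc n)
    show ?case
    proof (rule subrelI)
      fix x y assume "(x, y) \<in> Gn (Suc n)"
      then have "(qshift a q i x, qshift a p i y) \<in> Gn (Suc n)" for i
        using Gn_SucD Suc by blast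
      then show "(x, y) \<in> Gn (Suc (Suc n))" by (rule Gn_SucI)
    qed
  qed
  have Gn_mono: "Gn m \<subseteq> Gn n" if "m \<le> n" for m n
    using that Gn_step by (rule lift_Suc_mono_le[rotated])
  have Gn_add: "(x + x', y + y') \<in> Gn n" if "(x, y) \<in> Gn n" "(x', y') \<in> Gn n" for x y x' y' n
    using that
  proof (induction n arbitrary: x y x' y')
    case 0
    then show ?case unfolding Gn_0 G\<^sub>0_def using L_add by (auto simp flip: qact_add_left)
  next
    case (Suc n)
    show ?case
      by (intro Gn_SucI) (simp only: qshift_add, intro Suc.IH Gn_SucD Suc.prems)
  qed
  have Gn_scale: "(nc_const c * x, nc_const c * y) \<in> Gn n" if "(x, y) \<in> Gn n" for x y c n
    using that
  proof (induction n arbitrary: x y)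
    case 0
    then show ?case unfolding Gn_0 G\<^sub>0_def using L_mult by (auto simp flip: qact_scale_left)
  next
    case (Suc n)
    show ?case
      by (intro Gn_SucI) (simp only: qshift_scale, intro Suc.IH Gn_SucD Suc.prems)
  qed
  have G_add: "(x + x', y + y') \<in> G" if xy: "(x, y) \<in> G" "(x', y') \<in> G" for x y x' y'
  proof -
    from xy obtain m n where mn: "(x, y) \<in> Gn m" "(x', y') \<in> Gn n" by (auto simp: G_def)
    with Gn_mono[of m "max m n"] Gn_mono[of n "max m n"]
    have "(x + x', y + y') \<in> Gn (max m n)" by (intro Gn_add) auto
    then show ?thesis by (auto simp: G_def)
  qed
  have G_scale: "(nc_const c * x, nc_const c * y) \<in> G" if "(x, y) \<in> G" for x y c
    using that Gn_scale unfolding G_def by blast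
  have Gn_zero: "(0, 0) \<in> Gn n" for n
  proof -
    have "Gn 0 \<noteq> {}" using nz(1) by (auto simp: Gn_0 G\<^sub>0_def)
    then obtain x y where "(x, y) \<in> Gn 0" by auto
    from Gn_scale[OF this, of 0] have "(0, 0) \<in> Gn 0" by simp
    with Gn_mono[of 0 n] show ?thesis by auto
  qed
  \<comment> \<open>Multiplication by a shifted variable is a section of its coordinate map, and the
    other coordinates vanish. With scalars and sums this gives closure under left
    multiplication.\<close>
  have G_shifted: "(shifted_var a j * x, shifted_var a j * y) \<in> G" if "(x, y) \<in> G" for x y j
  proof -
    from that obtain n where "(x, y) \<in> Gn n" by (auto simp: G_def)
    with Gn_zero have "(shifted_var a j * x, shifted_var a j * y) \<in> Gn (Suc n)"
      by (intro Gn_SucI) (auto simp: qshift_shifted)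
    then show ?thesis by (auto simp: G_def)
  qed
  have G_mult: "(r * x, r * y) \<in> G" if "(x, y) \<in> G" for x y r
    using that
  proof (induction r arbitrary: x y rule: nc_poly_induct)
    case (const c)
    then show ?case by (rule G_scale)
  next
    case (add f g)
    then show ?case by (auto simp: distrib_right intro: G_add)
  next
    case (var i f)
    have "nc_var i * f * z = shifted_var a i * (f * z) + nc_const (a i) * (f * z)" for z
      by (simp add: shifted_var_def left_diff_distrib mult.assoc)
    then show ?case
      using G_add[OF G_shifted[OF var.IH[OF var.prems], of i] G_scale[OF var.IH[OF var.prems], of "a i"]]
      by (simp only:)
  qed
  have G_diff: "(x - x', y - y') \<in> G" if "(x, y) \<in> G" "(x', y') \<in> G" for x y x' y'
    using G_add[OF that(1) G_mult[OF that(2), of "- 1"]] by simp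
  have G_zero: "(0, 0) \<in> G" using Gn_zero by (auto simp: G_def)
  have G_shift: "(qshift a q i x, qshift a p i y) \<in> G" if "(x, y) \<in> G" for i x y
  proof -
    from that obtain n where "(x, y) \<in> Gn n" by (auto simp: G_def)
    with Gn_step have "(x, y) \<in> Gn (Suc n)" by blast
    from Gn_SucD[OF this] show ?thesis unfolding G_def by blast
  qed
  have G_left_quot_fst: "\<exists>z. (left_quot a i x, z) \<in> G" if "(x, y) \<in> G" "eval_point x a = 0" for x y i
    using G_shift[OF that(1), of i] that(2) by (auto simp: qshift_eval_0)
  have G_left_quot_snd: "\<exists>z. (z, left_quot a i y) \<in> G" if "(x, y) \<in> G" "eval_point y a = 0" for x y i
    using G_shift[OF that(1), of i] that(2) by (auto simp: qshift_eval_0)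
  have quot_1: "left_quot a i 1 = 0" for i
    using left_quot_const[of a i 1] by simp
  \<comment> \<open>All coordinates of \<open>q\<close> with respect to \<open>q\<close> vanish, and
    those of \<open>p\<close> with respect to \<open>p\<close>, so both pairs enter at the first
    stage.\<close>
  have qG: "(q, 0) \<in> G" and pG: "(0, p) \<in> G"
  proof -
    have "(q, 0) \<in> Gn (Suc 0)" "(0, p) \<in> Gn (Suc 0)"
      using qshift_mult[OF qa, of _ 1] qshift_mult[OF pa, of _ 1] Gn_zero quot_1
      by (auto intro!: Gn_SucI)
    then show "(q, 0) \<in> G" "(0, p) \<in> G" by (auto simp: G_def)
  qed
  \<comment> \<open>\<open>G\<close> is single-valued modulo \<open>p\<close>. Coordinate maps lower
    the stage; at stage 0 the degree bound forces a multiple of \<open>q\<close> to be 0, and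
    \<open>ker\<close> applies.\<close>
  have G_ker: "y \<in> range (\<lambda>r. r * p)" if "(x, y) \<in> G" "x \<in> range (\<lambda>r. r * q)" for x y
  proof -
    have "y \<in> range (\<lambda>r. r * p)" if "(x, y) \<in> Gn n" "x \<in> range (\<lambda>r. r * q)" for n
      using that
    proof (induction n arbitrary: x y)
      case 0
      then obtain h where h: "h \<in> L" "x = qact a q h t" "y = qact a p h s"
        by (auto simp: Gn_0 G\<^sub>0_def)
      then have "x \<in> deg_below (nc_deg q)" using t by (auto intro: qact_deg_below deg_below_nc_deg)
      with 0 have "x = 0" by (intro multiple_deg_below)
      with h ker have "y = 0 * p" by simp
      then show ?case by blast
    next
      case (Suc n)
      have "qshift a p i y \<in> range (\<lambda>r. r * p)" for i
        using Suc.IH[OF Gn_SucD[OF Suc.prems(1), of i]] Suc.prems(2) qshift_multiple_iff[OF qa] by blast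
      then show ?case using qshift_multiple_iff[OF pa] by blast
    qed
    with that show ?thesis by (auto simp: G_def)
  qed
  have h0: "(qact a q h\<^sub>0 t, qact a p h\<^sub>0 s) \<in> G"
    using nz(1) Gn_0 unfolding G_def G\<^sub>0_def by blast
  have one_multiple: False if "1 \<in> range (\<lambda>r. r * f)" "nc_irreducible f" for f :: "('g, 'k) free_algebra"
  proof -
    from that(1) obtain r where r: "1 = r * f" by blast
    then have "r \<noteq> 0" "f \<noteq> 0" by auto
    with r have "nc_deg (1 :: ('g, 'k) free_algebra) = nc_deg r + nc_deg f" using nc_deg_mult(2)[of r f] by simp
    moreover have "\<not> nonconstant (1 :: ('g, 'k) free_algebra)"
      unfolding nonconstant_def by (metis nc_const_1 rangeI)
    ultimately show False using that(2) by (simp add: nonconstant_iff_nc_deg nc_irreducible_def)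
  qed
  \<comment> \<open>The domain of \<open>G\<close> contains \<open>q\<close> and also the vector
    obtained from \<open>h\<^sub>0\<close>, which is no multiple of \<open>q\<close>; so it contains
    1. The range is treated in the same way below.\<close>
  have "\<exists>u. (1, u) \<in> G"
  proof -
    let ?J = "{x. \<exists>y. (x, y) \<in> G}"
    have "1 \<in> ?J \<or> ?J = range (\<lambda>r. r * q)"
    proof (rule left_ideal_irreducible[where a = a])
      show "left_quot a i f \<in> ?J" if "f \<in> ?J" "eval_point f a = 0" for f i
        using that G_left_quot_fst by blast
      show "f + g \<in> ?J" if "f \<in> ?J" "g \<in> ?J" for f g using that G_add by blast
      show "r * f \<in> ?J" if "f \<in> ?J" for r f using that G_mult by blast
    qed (use qG irr in auto)
    moreover have "?J \<noteq> range (\<lambda>r. r * q)"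
    proof
      assume "?J = range (\<lambda>r. r * q)"
      with h0 have "qact a q h\<^sub>0 t \<in> range (\<lambda>r. r * q)" by blast
      then have "qact a q h\<^sub>0 t = 0"
        by (rule multiple_deg_below) (use t in \<open>auto intro: qact_deg_below deg_below_nc_deg\<close>)
      with ker nz show False by blast
    qed
    ultimately show ?thesis by blast
  qed
  then obtain v where v: "(1, v) \<in> G" by blast
  have "\<exists>v. (v, 1) \<in> G"
  proof -
    let ?J = "{y. \<exists>x. (x, y) \<in> G}"
    have "1 \<in> ?J \<or> ?J = range (\<lambda>r. r * p)"
    proof (rule left_ideal_irreducible[where a = a])
      show "left_quot a i f \<in> ?J" if "f \<in> ?J" "eval_point f a = 0" for f i
        using that G_left_quot_snd by blast
      show "f + g \<in> ?J" if "f \<in> ?J" "g \<in> ?J" for f g using that G_add by blast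
      show "r * f \<in> ?J" if "f \<in> ?J" for r f using that G_mult by blast
    qed (use pG irr in auto)
    moreover have "?J \<noteq> range (\<lambda>r. r * p)"
    proof
      assume "?J = range (\<lambda>r. r * p)"
      with h0 have "qact a p h\<^sub>0 s \<in> range (\<lambda>r. r * p)" by blast
      then have "qact a p h\<^sub>0 s = 0"
        by (rule multiple_deg_below) (use s in \<open>auto intro: qact_deg_below deg_below_nc_deg\<close>)
      with nz show False by blast
    qed
    ultimately show ?thesis by blast
  qed
  then obtain u where u: "(u, 1) \<in> G" by blast
  \<comment> \<open>\<open>G\<close> is injective modulo \<open>q\<close>: otherwise 1 would be
    related to 0, hence 0 to 1, against single-valuedness.\<close>
  have ker_q: "x \<in> range (\<lambda>r. r * q)" if "(x, 0) \<in> G" for x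
  proof -
    let ?K = "{x. (x, 0) \<in> G}"
    have "1 \<in> ?K \<or> ?K = range (\<lambda>r. r * q)"
    proof (rule left_ideal_irreducible[where a = a])
      show "left_quot a i f \<in> ?K" if "f \<in> ?K" "eval_point f a = 0" for f i
        using that G_shift[of f 0 i] by (simp add: qshift_eval_0)
      show "f + g \<in> ?K" if "f \<in> ?K" "g \<in> ?K" for f g using that G_add[of f 0 g 0] by simp
      show "r * f \<in> ?K" if "f \<in> ?K" for r f using that G_mult[of f 0 r] by simp
    qed (use qG irr in auto)
    moreover have "1 \<notin> ?K"
    proof
      assume "1 \<in> ?K"
      then have "(u, 0) \<in> G" using G_mult[of 1 0 u] by simp
      from G_diff[OF u this] have "(0, 1) \<in> G" by simp
      moreover have "0 \<in> range (\<lambda>r. r * q)" by (metis mult_zero_left rangeI)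
      ultimately have "1 \<in> range (\<lambda>r. r * p)" by (rule G_ker)
      with one_multiple irr show False by blast
    qed
    ultimately show ?thesis using that by blast
  qed
  have ker_p: "y \<in> range (\<lambda>r. r * p)" if "(0, y) \<in> G" for y
    using that by (rule G_ker) (metis mult_zero_left rangeI)
  \<comment> \<open>Subtracting pairs of \<open>G\<close> with a common component leaves a zero
    entry, and the other entry is then a multiple of \<open>p\<close> or \<open>q\<close>. This
    yields all four relations.\<close>
  have "(0, q * v) \<in> G" using G_diff[OF G_mult[OF v, of q] qG] by simp
  then obtain v' where v': "q * v = v' * p" using ker_p by blast
  have "(p * u, 0) \<in> G" using G_diff[OF G_mult[OF u, of p] pG] by simp
  then obtain u' where u': "p * u = u' * q" using ker_q by blast
  have "(0, u * v - 1) \<in> G" using G_diff[OF G_mult[OF v, of u] u] by simp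
  then obtain c where c: "u * v - 1 = c * p" using ker_p by blast
  have "(v * u - 1, 0) \<in> G" using G_diff[OF G_mult[OF u, of v] v] by simp
  then obtain d where d: "v * u - 1 = d * q" using ker_q by blast
  have "p \<noteq> 0" "q \<noteq> 0" using pa qa by auto
  then show ?thesis
    by (rule stably_associatedI[OF _ _ u' v'])
      (use c d in \<open>simp_all add: diff_eq_eq add.commute\<close>)
qed

subsection \<open>Singular evaluations\<close>

lemma det_eval_mat_eq_0_iff:
  "det (eval_mat n f X) = 0 \<longleftrightarrow> (\<exists>v\<in>carrier_vec n. v \<noteq> 0\<^sub>v n \<and> eval_mat n f X *\<^sub>v v = 0\<^sub>v n)"
  using det_0_iff_vec_prod_zero[OF eval_mat_carrier[of n f X]] by auto

text \<open>With \<open>X\<close> and \<open>v\<close> fixed, each row \<open>c < n\<close> gives a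
  linear functional of \<open>f\<close>.\<close>

definition eval_coord ::
    "nat \<Rightarrow> ('g \<Rightarrow> 'k mat) \<Rightarrow> 'k vec \<Rightarrow> ('g, 'k::field) free_algebra \<Rightarrow> nat \<Rightarrow> 'k" where
  "eval_coord n X v f c = (\<Sum>b<n. eval_mat n f X $$ (c, b) * v $ b)"

lemma eval_coord_eq:
  "v \<in> carrier_vec n \<Longrightarrow> c < n \<Longrightarrow> (eval_mat n f X *\<^sub>v v) $ c = eval_coord n X v f c"
  by (simp add: eval_coord_def scalar_prod_def lessThan_atLeast0)

lemma eval_coord_add:
  "c < n \<Longrightarrow> eval_coord n X v (f + g) c = eval_coord n X v f c + eval_coord n X v g c"
  by (simp add: eval_coord_def eval_mat_add distrib_right sum.distrib)

lemma eval_coord_scale: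
  "c < n \<Longrightarrow> eval_coord n X v (nc_const k * f) c = k * eval_coord n X v f c"
  by (simp add: eval_coord_def eval_mat_scale sum_distrib_left mult.assoc)

lemma eval_coord_0: "c < n \<Longrightarrow> eval_coord n X v 0 c = 0"
  by (simp add: eval_coord_def eval_mat_0)

lemma eval_coord_1: "c < n \<Longrightarrow> eval_coord n X v 1 c = v $ c"
proof -
  assume c: "c < n"
  have "(\<Sum>b<n. 1\<^sub>m n $$ (c, b) * v $ b) = (\<Sum>b<n. if c = b then v $ b else 0)"
    using c by (intro sum.cong) auto
  with c show ?thesis by (simp add: eval_coord_def eval_mat_1)
qed

lemma eval_coord_const: "c < n \<Longrightarrow> eval_coord n X v (nc_const k) c = k * v $ c"
  using eval_coord_scale[of c n X v k 1] by (simp add: eval_coord_1)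

lemma eval_coord_sum:
  "c < n \<Longrightarrow> eval_coord n X v (sum f A) c = (\<Sum>x\<in>A. eval_coord n X v (f x) c)"
  by (induction A rule: infinite_finite_induct) (simp_all add: eval_coord_0 eval_coord_add)

lemma eval_coord_var_mult:
  assumes X: "\<And>i. X i \<in> carrier_mat n n" and c: "c < n"
  shows "eval_coord n X v (nc_var i * f) c = (\<Sum>b<n. X i $$ (c, b) * eval_coord n X v f b)"
proof -
  have "eval_coord n X v (nc_var i * f) c = (\<Sum>b<n. \<Sum>k<n. X i $$ (c, k) * eval_mat n f X $$ (k, b) * v $ b)"
    using c X[of i]
    by (simp add: eval_coord_def eval_mat_var_mult[of X n, OF X] scalar_prod_def lessThan_atLeast0
        sum_distrib_right)
  also have "\<dots> = (\<Sum>k<n. X i $$ (c, k) * eval_coord n X v f k)"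
    by (subst sum.swap) (simp add: eval_coord_def sum_distrib_left mult.assoc)
  finally show ?thesis .
qed

lemma eval_coord_shifted:
  assumes X: "\<And>i. X i \<in> carrier_mat n n" and c: "c < n"
  shows "eval_coord n X v (shifted_var a i * f) c
    = (\<Sum>b<n. (X i $$ (c, b) - (if b = c then a i else 0)) * eval_coord n X v f b)"
proof -
  have "shifted_var a i * f = nc_var i * f + nc_const (- a i) * f"
    by (simp add: shifted_var_def left_diff_distrib nc_const_uminus)
  then have "eval_coord n X v (shifted_var a i * f) c
      = (\<Sum>b<n. X i $$ (c, b) * eval_coord n X v f b) - a i * eval_coord n X v f c"
    using c by (simp only: eval_coord_add eval_coord_scale eval_coord_var_mult[of X n, OF X c])
      simp
  also have "a i * eval_coord n X v f c = (\<Sum>b<n. (if b = c then a i else 0) * eval_coord n X v f b)"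
  proof -
    have "(\<Sum>b<n. (if b = c then a i else 0) * eval_coord n X v f b)
        = (\<Sum>b<n. if b = c then a i * eval_coord n X v f b else 0)"
      by (intro sum.cong) auto
    with c show ?thesis by simp
  qed
  finally show ?thesis by (simp add: left_diff_distrib sum_subtractf)
qed

text \<open>
  \<open>companion\<close> expresses that the shifted matrices act on the linear functionals on the quotient module
  of \<open>1 - h\<close> by transposing the coordinate maps: the row of a nonempty word \<open>w i\<close> sends the functional
  to the one of \<open>w\<close>, and the row of the empty word contains the coefficients of \<open>h\<close>.
\<close>

definition companion ::
    "('g \<Rightarrow> 'k) \<Rightarrow> ('g::finite, 'k::field) free_algebra \<Rightarrow> nat \<Rightarrow> ('g \<Rightarrow> 'k mat) \<Rightarrow> (nat \<Rightarrow> 'g list) \<Rightarrow> bool" where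
  "companion a h n X e \<longleftrightarrow> (\<forall>i. X i \<in> carrier_mat n n) \<and> inj_on e {..<n} \<and>
     (\<exists>N > nc_deg h. e ` {..<n} = {w. length w < N}) \<and>
     (\<forall>z. \<forall>c<n. (\<Sum>i\<in>UNIV. \<Sum>b<n. (X i $$ (c, b) - (if b = c then a i else 0)) * z i (e b)) =
       (if e c = [] then \<Sum>w\<in>Poly_Mapping.keys h. Poly_Mapping.lookup h w *
            z (last (letters w)) (butlast (letters w))
        else z (last (e c)) (butlast (e c))))"

lemma companion_exists:
  fixes h :: "('g::finite, 'k::field) free_algebra"
  assumes h0: "Poly_Mapping.lookup h 0 = 0"
  obtains n X e where "companion a h n X e"
proof -
  \<comment> \<open>Words shorter than \<open>N\<close> include the empty word and every word of
    \<open>h\<close> without its last letter.\<close>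
  define N where "N = Suc (nc_deg h)"
  define W where "W = {w :: 'g list. length w < N}"
  have "finite W"
    unfolding W_def by (rule finite_subset[OF _ finite_lists_length_le[of UNIV N]]) auto
  then obtain e and n :: nat where e: "bij_betw e {..<n} W"
    using ex_bij_betw_nat_finite[of W] by (metis lessThan_atLeast0)
  \<comment> \<open>Entries of the \<open>i\<close>-th shifted matrix, with rows \<open>w\<close>
    and columns \<open>x\<close>; \<open>X\<close> puts \<open>a i\<close> back on the
    diagonal.\<close>
  define Y :: "'g \<Rightarrow> 'g list \<Rightarrow> 'g list \<Rightarrow> 'k" where
    "Y i w x = (if w = [] then Poly_Mapping.lookup h (Word (x @ [i])) else if w = x @ [i] then 1 else 0)" for i w x
  define X where "X i = mat n n (\<lambda>(c, b). Y i (e c) (e b) + (if b = c then a i else 0))" for i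
  have "(\<Sum>i\<in>UNIV. \<Sum>b<n. (X i $$ (c, b) - (if b = c then a i else 0)) * z i (e b)) =
       (if e c = [] then \<Sum>w\<in>Poly_Mapping.keys h. Poly_Mapping.lookup h w *
            z (last (letters w)) (butlast (letters w))
        else z (last (e c)) (butlast (e c)))" (is "?lhs = _") if c: "c < n" for z c
  proof -
    have "?lhs = (\<Sum>i\<in>UNIV. \<Sum>b<n. Y i (e c) (e b) * z i (e b))"
      using c by (intro sum.cong refl) (simp add: X_def)
    also have "\<dots> = (\<Sum>i\<in>UNIV. \<Sum>x\<in>W. Y i (e c) x * z i x)"
      by (intro sum.cong refl sum.reindex_bij_betw e)
    also have "\<dots> = (\<Sum>(i, x)\<in>UNIV \<times> W. Y i (e c) x * z i x)"
      by (rule sum.cartesian_product)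
    finally have lhs: "?lhs = (\<Sum>(i, x)\<in>UNIV \<times> W. Y i (e c) x * z i x)" .
    show ?thesis
    proof (cases "e c = []")
      case True
      have "(\<Sum>(i, x)\<in>UNIV \<times> W. Y i (e c) x * z i x)
        = (\<Sum>w\<in>Poly_Mapping.keys h. Poly_Mapping.lookup h w * z (last (letters w)) (butlast (letters w)))"
      \<comment> \<open>Appending the letter turns pairs into nonempty words. Pairs outside the
        support of \<open>h\<close> contribute 0, and \<open>h0\<close> keeps the empty word out of
        the support.\<close>
      proof (rule sum.reindex_bij_witness_not_neutral[where
            S' = "{(i, x). (i, x) \<in> UNIV \<times> W \<and> Poly_Mapping.lookup h (Word (x @ [i])) = 0}" and T' = "{}"
            and j = "\<lambda>(i, x). Word (x @ [i])" and i = "\<lambda>w. (last (letters w), butlast (letters w))"])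
        show "finite {(i, x). (i, x) \<in> UNIV \<times> W \<and> Poly_Mapping.lookup h (Word (x @ [i])) = 0}"
          by (rule finite_subset[of _ "UNIV \<times> W"]) (use \<open>finite W\<close> in auto)
      next
        fix w assume w: "w \<in> Poly_Mapping.keys h - {}"
        with h0 have ne: "letters w \<noteq> []"
          by (cases w) (auto simp: in_keys_iff zero_free_monoid_def)
        then show wl: "(\<lambda>(i, x). Word (x @ [i])) (last (letters w), butlast (letters w)) = w" by simp
        from w deg_below_nc_deg[of h] have "length (letters w) < N" by (auto simp: deg_below_def N_def)
        then have "butlast (letters w) \<in> W" by (simp add: W_def)
        with w wl show "(last (letters w), butlast (letters w)) \<in>
            UNIV \<times> W - {(i, x). (i, x) \<in> UNIV \<times> W \<and> Poly_Mapping.lookup h (Word (x @ [i])) = 0}"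
          by (auto simp: in_keys_iff)
      qed (auto simp: Y_def True in_keys_iff)
      with lhs True show ?thesis by simp
    next
      case False
      have "e c \<in> W" using e c by (auto simp: bij_betw_def)
      then have "butlast (e c) \<in> W" by (simp add: W_def)
      have "(\<Sum>(i, x)\<in>UNIV \<times> W. Y i (e c) x * z i x)
          = (\<Sum>y\<in>UNIV \<times> W. if y = (last (e c), butlast (e c)) then z (last (e c)) (butlast (e c)) else 0)"
        using False by (intro sum.cong refl) (auto simp: Y_def split: if_splits)
      also have "\<dots> = z (last (e c)) (butlast (e c))"
        using \<open>finite W\<close> \<open>butlast (e c) \<in> W\<close> by simp
      finally show ?thesis using lhs False by simp
    qed
  qed
  moreover have "X i \<in> carrier_mat n n" for i by (simp add: X_def)
  moreover have "inj_on e {..<n}" "e ` {..<n} = {w. length w < N}"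
    using e by (simp_all add: bij_betw_def W_def)
  ultimately have "companion a h n X e"
    unfolding companion_def N_def by blast
  then show ?thesis by (rule that)
qed

lemma companion_nonempty:
  assumes "companion a h n X e"
  obtains c where "c < n" "e c = []"
proof -
  from assms obtain N where "nc_deg h < N" "e ` {..<n} = {w. length w < N}"
    by (auto simp: companion_def)
  then have "[] \<in> e ` {..<n}" by auto
  then show ?thesis using that by auto
qed

section \<open>Words acting through the coordinate maps, and the kernel of a polynomial at companion
  matrices\<close>

definition qword :: "('g::finite \<Rightarrow> 'k::field) \<Rightarrow> ('g, 'k) free_algebra \<Rightarrow> 'g list \<Rightarrow> ('g, 'k) free_algebra \<Rightarrow> ('g, 'k) free_algebra" where
  "qword a p w = foldr (qshift a p) w"

lemma qword_simps [simp]: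
  "qword a p [] f = f" "qword a p (i # w) f = qshift a p i (qword a p w f)"
  "qword a p (w @ [i]) f = qword a p w (qshift a p i f)"
  by (simp_all add: qword_def)

lemma qword_add: "qword a p w (f + g) = qword a p w f + qword a p w g"
  by (induction w) (simp_all add: qshift_add)

lemma qword_scale: "qword a p w (nc_const c * f) = nc_const c * qword a p w f"
  by (induction w) (simp_all add: qshift_scale)

lemma qword_0 [simp]: "qword a p w 0 = 0"
  by (induction w) simp_all

lemma qword_deg_below:
  "p \<in> deg_below (Suc d) \<Longrightarrow> f \<in> deg_below d \<Longrightarrow> qword a p w f \<in> deg_below d"
  by (induction w) (simp_all add: qshift_deg_below)

lemma qact_qword:
  "qact a p h f = (\<Sum>w\<in>Poly_Mapping.keys h. nc_const (Poly_Mapping.lookup h w) * qword a p (letters w) f)"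
  by (simp add: qact_def lin_ext_def qword_def)

lemma qword_butlast: "w \<noteq> [] \<Longrightarrow> qword a p (butlast w) (qshift a p (last w) f) = qword a p w f"
  by (metis append_butlast_last_id qword_simps(3))

lemma keys_nonempty:
  "Poly_Mapping.lookup h 0 = 0 \<Longrightarrow> w \<in> Poly_Mapping.keys h \<Longrightarrow> letters w \<noteq> []"
  by (cases w) (auto simp: in_keys_iff zero_free_monoid_def)

text \<open>If q(X) kills \<open>v\<close>, the coordinates of f(X)v depend on \<open>f\<close> only
  modulo \<open>q\<close>. The rows of \<open>X\<close> then express every coordinate through the
  functional of the empty word and make that functional invariant under \<open>h\<close>. As
  \<open>h\<close> annihilates \<open>V\<^sub>q\<close>, the functional vanishes there.\<close>

lemma companion_nonsingular:
  fixes q :: "('g::finite, 'k::field) free_algebra"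
  assumes comp: "companion a h n X e" and h0: "Poly_Mapping.lookup h 0 = 0"
    and qa: "eval_point q a \<noteq> 0" and d: "nc_deg q > 0"
    and ann: "\<And>t. t \<in> deg_below (nc_deg q) \<Longrightarrow> qact a q h t = 0"
  shows "det (eval_mat n q X) \<noteq> 0"
proof
  assume "det (eval_mat n q X) = 0"
  then obtain v where v: "v \<in> carrier_vec n" "v \<noteq> 0\<^sub>v n" "eval_mat n q X *\<^sub>v v = 0\<^sub>v n"
    by (auto simp: det_eval_mat_eq_0_iff)
  have X: "\<And>i. X i \<in> carrier_mat n n" and inj: "inj_on e {..<n}"
    and z: "\<And>z c. c < n \<Longrightarrow> (\<Sum>i\<in>UNIV. \<Sum>b<n. (X i $$ (c, b) - (if b = c then a i else 0)) * z i (e b)) =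
       (if e c = [] then \<Sum>w\<in>Poly_Mapping.keys h. Poly_Mapping.lookup h w *
            z (last (letters w)) (butlast (letters w))
        else z (last (e c)) (butlast (e c)))"
    using comp unfolding companion_def by blast+
  obtain N where N: "nc_deg h < N" "e ` {..<n} = {w. length w < N}"
    using comp unfolding companion_def by blast
  define \<Psi> where "\<Psi> w f = eval_coord n X v f (inv_into {..<n} e w)" for w f
  have \<Psi>_e: "\<Psi> (e c) f = eval_coord n X v f c" if "c < n" for c f
    using that inj by (simp add: \<Psi>_def)
  have q0: "eval_coord n X v q c = 0" if "c < n" for c
    using that v by (metis eval_coord_eq index_zero_vec(1))
  have step: "\<Psi> (e c) f = (if e c = [] then \<Sum>w\<in>Poly_Mapping.keys h. Poly_Mapping.lookup h w *
            \<Psi> (butlast (letters w)) (qshift a q (last (letters w)) f)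
        else \<Psi> (butlast (e c)) (qshift a q (last (e c)) f))" if c: "c < n" for c f
  proof -
    have "\<Psi> (e c) f = eval_coord n X v ((\<Sum>i\<in>UNIV. shifted_var a i * qshift a q i f)
        + nc_const (eval_point f a / eval_point q a) * q) c"
      using qshift_expansion[OF qa, of f] by (simp add: \<Psi>_e c)
    also have "\<dots> = (\<Sum>i\<in>UNIV. \<Sum>b<n. (X i $$ (c, b) - (if b = c then a i else 0)) * \<Psi> (e b) (qshift a q i f))"
      using c by (simp add: eval_coord_add eval_coord_sum eval_coord_scale q0
          eval_coord_shifted[of X n, OF X] \<Psi>_e)
    also have "\<dots> = (if e c = [] then \<Sum>w\<in>Poly_Mapping.keys h. Poly_Mapping.lookup h w *
            \<Psi> (butlast (letters w)) (qshift a q (last (letters w)) f)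
        else \<Psi> (butlast (e c)) (qshift a q (last (e c)) f))"
      by (rule z[OF c])
    finally show ?thesis .
  qed
  have word: "\<Psi> w f = \<Psi> [] (qword a q w f)" if "length w < N" for w f
    using that
  proof (induction w arbitrary: f rule: rev_induct)
    case (snoc i w)
    then have "w @ [i] \<in> e ` {..<n}" using N by simp
    then obtain c where c: "c < n" "w @ [i] = e c" by auto
    then have "e c \<noteq> []" by (metis append_is_Nil_conv not_Cons_self2)
    with step[OF c(1), of f] have "\<Psi> (w @ [i]) f = \<Psi> w (qshift a q i f)"
      by (simp flip: c(2))
    with snoc show ?case by simp
  qed simp
  obtain c\<^sub>0 where c0: "c\<^sub>0 < n" "e c\<^sub>0 = []" using companion_nonempty[OF comp] .
  have \<Psi>_Nil: "\<Psi> [] f = eval_coord n X v f c\<^sub>0" for f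
    using \<Psi>_e[OF c0(1)] c0 by simp
  have fixed: "\<Psi> [] f = \<Psi> [] (qact a q h f)" for f
  proof -
    have "\<Psi> [] f = (\<Sum>w\<in>Poly_Mapping.keys h. Poly_Mapping.lookup h w *
            \<Psi> (butlast (letters w)) (qshift a q (last (letters w)) f))"
      using step[OF c0(1), of f] c0 by simp
    also have "\<dots> = (\<Sum>w\<in>Poly_Mapping.keys h. Poly_Mapping.lookup h w * \<Psi> [] (qword a q (letters w) f))"
    proof (intro sum.cong refl)
      fix w assume w: "w \<in> Poly_Mapping.keys h"
      with deg_below_nc_deg[of h] N(1) have "length (butlast (letters w)) < N"
        by (auto simp: deg_below_def)
      from word[OF this] keys_nonempty[OF h0 w]
      show "Poly_Mapping.lookup h w * \<Psi> (butlast (letters w)) (qshift a q (last (letters w)) f)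
          = Poly_Mapping.lookup h w * \<Psi> [] (qword a q (letters w) f)"
        by (simp only: qword_butlast simp_thms)
    qed
    also have "\<dots> = \<Psi> [] (qact a q h f)"
      using c0 by (simp add: \<Psi>_Nil qact_qword eval_coord_sum eval_coord_scale)
    finally show ?thesis .
  qed
  have zero: "\<Psi> [] t = 0" if "t \<in> deg_below (nc_deg q)" for t
    using fixed[of t] ann[OF that] c0 by (simp add: \<Psi>_Nil eval_coord_0)
  have one: "1 \<in> deg_below (nc_deg q)"
    using deg_below_const[of 1 "nc_deg q - 1"] d by simp
  \<comment> \<open>Taking \<open>f\<close> to be 1 recovers the entries of \<open>v\<close>
    itself.\<close>
  have "v $ c = 0" if "c < n" for c
  proof -
    have "e c \<in> e ` {..<n}" using that by simp
    with N have "length (e c) < N" by simp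
    from word[OF this, of 1] zero[OF qword_deg_below[OF deg_below_nc_deg one]]
    show ?thesis using that by (simp add: \<Psi>_e eval_coord_1)
  qed
  with v(1,2) show False by auto
qed

text \<open>An endomorphism of a finite-dimensional space and its transpose have the same
  eigenvalues. The fixed vector makes the matrix \<open>B\<close> of A - 1 singular, and a kernel
  vector of the transpose lists the coefficients of \<open>F\<close>.\<close>

lemma fixed_functional_exists:
  fixes A :: "('g::finite, 'k::field) free_algebra \<Rightarrow> ('g, 'k) free_algebra"
  assumes add: "\<And>f g. A (f + g) = A f + A g" and scale: "\<And>c f. A (nc_const c * f) = nc_const c * A f"
    and closed: "\<And>f. f \<in> deg_below d \<Longrightarrow> A f \<in> deg_below d"
    and s: "s \<in> deg_below d" "s \<noteq> 0" "A s = s"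
  obtains F :: "('g, 'k) free_algebra \<Rightarrow> 'k" and r where
    "\<And>f g. F (f + g) = F f + F g" "\<And>c f. F (nc_const c * f) = c * F f"
    "\<And>f. f \<in> deg_below d \<Longrightarrow> F (A f) = F f" "r \<in> deg_below d" "F r \<noteq> 0"
proof -
  define W where "W = {w :: 'g free_monoid. length (letters w) < d}"
  have finW: "finite W" unfolding W_def by (rule finite_words)
  obtain u and m :: nat where u: "bij_betw u {..<m} W"
    using ex_bij_betw_nat_finite[OF finW] by (metis lessThan_atLeast0)
  have uW: "u c \<in> W" if "c < m" for c using u that by (auto simp: bij_betw_def)
  let ?b = "\<lambda>c. Poly_Mapping.single (u c) (1::'k)"
  have expand: "f = (\<Sum>c<m. nc_const (Poly_Mapping.lookup f (u c)) * ?b c)" if f: "f \<in> deg_below d" for f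
  proof -
    have "(\<Sum>c<m. nc_const (Poly_Mapping.lookup f (u c)) * ?b c)
        = (\<Sum>w\<in>W. Poly_Mapping.single w (Poly_Mapping.lookup f w))"
      unfolding nc_const_single using sum.reindex_bij_betw[OF u] by simp
    also have "\<dots> = f"
    proof (rule poly_mapping_eqI)
      fix w
      have "Poly_Mapping.lookup f w = 0" if "w \<notin> W"
        using that f by (auto simp: W_def deg_below_lookup)
      with finW show "Poly_Mapping.lookup (\<Sum>w\<in>W. Poly_Mapping.single w (Poly_Mapping.lookup f w)) w
          = Poly_Mapping.lookup f w"
        by (auto simp: lookup_sum lookup_single when_def)
    qed
    finally show ?thesis by simp
  qed
  have A0: "A 0 = 0" using scale[of 0 0] by simp
  have A_sum: "A (sum f S) = (\<Sum>x\<in>S. A (f x))" for f :: "nat \<Rightarrow> _" and S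
    by (induction S rule: infinite_finite_induct) (simp_all add: A0 add)
  define B where "B = mat m m (\<lambda>(r, c). Poly_Mapping.lookup (A (?b c) - ?b c) (u r))"
  have B: "B \<in> carrier_mat m m" by (simp add: B_def)
  define x where "x = vec m (\<lambda>c. Poly_Mapping.lookup s (u c))"
  have x: "x \<in> carrier_vec m" by (simp add: x_def)
  have "x \<noteq> 0\<^sub>v m"
  proof
    assume "x = 0\<^sub>v m"
    then have "Poly_Mapping.lookup s (u c) = 0" if "c < m" for c
      using that by (metis x_def index_vec index_zero_vec(1))
    with expand[OF s(1)] s(2) show False by simp
  qed
  moreover have "B *\<^sub>v x = 0\<^sub>v m"
  proof (rule eq_vecI)
    fix r assume "r < dim_vec (0\<^sub>v m)"
    then have r: "r < m" by simp
    have "(B *\<^sub>v x) $ r = (\<Sum>c<m. Poly_Mapping.lookup (A (?b c) - ?b c) (u r) * Poly_Mapping.lookup s (u c))"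
      using r by (simp add: B_def x_def scalar_prod_def lessThan_atLeast0)
    also have "\<dots> = Poly_Mapping.lookup (\<Sum>c<m. nc_const (Poly_Mapping.lookup s (u c)) * (A (?b c) - ?b c)) (u r)"
      by (simp add: lookup_sum lookup_nc_const_mult mult.commute)
    also have "(\<Sum>c<m. nc_const (Poly_Mapping.lookup s (u c)) * (A (?b c) - ?b c))
        = A (\<Sum>c<m. nc_const (Poly_Mapping.lookup s (u c)) * ?b c)
          - (\<Sum>c<m. nc_const (Poly_Mapping.lookup s (u c)) * ?b c)"
      by (simp add: A_sum scale right_diff_distrib sum_subtractf)
    also have "\<dots> = 0" unfolding expand[OF s(1), symmetric] using s(3) by simp
    finally show "(B *\<^sub>v x) $ r = 0\<^sub>v m $ r" using r by simp
  qed (simp add: B_def)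
  ultimately have "det B = 0" using det_0_iff_vec_prod_zero[OF B] x by blast
  then have "det B\<^sup>T = 0" using det_transpose[OF B] by simp
  then obtain \<phi> where \<phi>: "\<phi> \<in> carrier_vec m" "\<phi> \<noteq> 0\<^sub>v m" "B\<^sup>T *\<^sub>v \<phi> = 0\<^sub>v m"
    using det_0_iff_vec_prod_zero[of "B\<^sup>T" m] B by auto
  define F where "F f = (\<Sum>r<m. \<phi> $ r * Poly_Mapping.lookup f (u r))" for f
  have F_add: "F (f + g) = F f + F g" for f g
    by (simp add: F_def lookup_add distrib_left sum.distrib)
  have F_scale: "F (nc_const c * f) = c * F f" for c f
    by (simp add: F_def lookup_nc_const_mult sum_distrib_left mult.left_commute)
  have F_0: "F 0 = 0" by (simp add: F_def)
  have F_sum: "F (sum f S) = (\<Sum>x\<in>S. F (f x))" for f :: "nat \<Rightarrow> _" and S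
    by (induction S rule: infinite_finite_induct) (simp_all add: F_0 F_add)
  have F_diff: "F (f - g) = F f - F g" for f g
    by (simp add: F_def lookup_minus right_diff_distrib sum_subtractf)
  have basis: "F (A (?b c)) = F (?b c)" if c: "c < m" for c
  proof -
    have "(B\<^sup>T *\<^sub>v \<phi>) $ c = (\<Sum>r<m. Poly_Mapping.lookup (A (?b c) - ?b c) (u r) * \<phi> $ r)"
      using c \<phi>(1) B by (simp add: B_def scalar_prod_def lessThan_atLeast0)
    also have "\<dots> = F (A (?b c) - ?b c)" by (simp add: F_def mult.commute)
    finally show ?thesis using \<phi>(3) c by (simp add: F_diff)
  qed
  obtain r where r: "r < m" "\<phi> $ r \<noteq> 0"
    using \<phi>(1,2) by (metis carrier_vecD eq_vecI index_zero_vec)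
  have "F (?b r) = (\<Sum>r'<m. if r' = r then \<phi> $ r' else 0)"
    unfolding F_def using u r(1)
    by (intro sum.cong refl) (auto simp: lookup_single when_def bij_betw_def inj_on_eq_iff)
  with r have Fr: "F (?b r) \<noteq> 0" by simp
  show ?thesis
  proof (rule that[of F "?b r", OF F_add F_scale _ _ Fr])
    show "?b r \<in> deg_below d" using uW[OF r(1)] by (auto simp: W_def intro: deg_below_single)
    fix f :: "('g, 'k) free_algebra" assume f: "f \<in> deg_below d"
    have "F (A (\<Sum>c<m. nc_const (Poly_Mapping.lookup f (u c)) * ?b c))
        = F (\<Sum>c<m. nc_const (Poly_Mapping.lookup f (u c)) * ?b c)"
      by (simp add: A_sum scale F_sum F_scale basis)
    then show "F (A f) = F f" using expand[OF f] by simp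
  qed
qed

text \<open>A functional \<open>F\<close> invariant under \<open>h\<close> supplies a vector
  \<open>v\<close>: the entry in the row of a word is \<open>F\<close> at the result of applying
  that word to 1. By induction on the degree, f(X)v arises from \<open>f\<close> in the same way
  when \<open>f\<close> lies in \<open>V\<^sub>p\<close>.\<close>

lemma companion_singular:
  fixes p :: "('g::finite, 'k::field) free_algebra"
  assumes comp: "companion a h n X e" and h0: "Poly_Mapping.lookup h 0 = 0"
    and pa: "eval_point p a \<noteq> 0" and d: "nc_deg p > 0"
    and s: "s \<in> deg_below (nc_deg p)" "s \<noteq> 0" "qact a p h s = s"
  shows "det (eval_mat n p X) = 0"
proof -
  let ?d = "nc_deg p"
  have X: "\<And>i. X i \<in> carrier_mat n n"
    and z: "\<And>z c. c < n \<Longrightarrow> (\<Sum>i\<in>UNIV. \<Sum>b<n. (X i $$ (c, b) - (if b = c then a i else 0)) * z i (e b)) =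
       (if e c = [] then \<Sum>w\<in>Poly_Mapping.keys h. Poly_Mapping.lookup h w *
            z (last (letters w)) (butlast (letters w))
        else z (last (e c)) (butlast (e c)))"
    using comp unfolding companion_def by blast+
  obtain F r\<^sub>0 where F_add: "\<And>f g. F (f + g) = F f + F g" and F_scale: "\<And>c f. F (nc_const c * f) = c * F f"
    and F_fixed: "\<And>f. f \<in> deg_below ?d \<Longrightarrow> F (qact a p h f) = F f" and r0: "r\<^sub>0 \<in> deg_below ?d" "F r\<^sub>0 \<noteq> 0"
    by (rule fixed_functional_exists[of "qact a p h" ?d s, OF qact_add qact_scale
          qact_deg_below[OF deg_below_nc_deg] s]) (assumption, (rule that; assumption))
  have F_0: "F 0 = 0" using F_scale[of 0 0] by simp
  have F_sum: "F (sum f S) = (\<Sum>x\<in>S. F (f x))" for f :: "'g free_monoid \<Rightarrow> _" and S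
    by (induction S rule: infinite_finite_induct) (simp_all add: F_0 F_add)
  define \<Psi> where "\<Psi> w f = F (qword a p w f)" for w f
  have \<Psi>_add: "\<Psi> w (f + g) = \<Psi> w f + \<Psi> w g" for w f g
    by (simp add: \<Psi>_def qword_add F_add)
  have \<Psi>_scale: "\<Psi> w (nc_const c * f) = c * \<Psi> w f" for w f c
    by (simp add: \<Psi>_def qword_scale F_scale)
  let ?Y = "\<lambda>i c b. X i $$ (c, b) - (if b = c then a i else 0)"
  have step: "(\<Sum>i\<in>UNIV. \<Sum>b<n. ?Y i c b * \<Psi> (e b) (qshift a p i f)) = \<Psi> (e c) f"
    if c: "c < n" and f: "f \<in> deg_below ?d" for c f
  proof (cases "e c = []")
    case True
    have "(\<Sum>i\<in>UNIV. \<Sum>b<n. ?Y i c b * \<Psi> (e b) (qshift a p i f))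
        = (\<Sum>w\<in>Poly_Mapping.keys h. Poly_Mapping.lookup h w *
            \<Psi> (butlast (letters w)) (qshift a p (last (letters w)) f))"
      using z[OF c, of "\<lambda>i w. \<Psi> w (qshift a p i f)"] True by simp
    also have "\<dots> = (\<Sum>w\<in>Poly_Mapping.keys h. F (nc_const (Poly_Mapping.lookup h w) * qword a p (letters w) f))"
      by (intro sum.cong refl) (simp add: \<Psi>_def F_scale qword_butlast keys_nonempty[OF h0])
    also have "\<dots> = F (qact a p h f)" by (simp add: qact_qword F_sum)
    finally show ?thesis using True F_fixed[OF f] by (simp add: \<Psi>_def)
  next
    case False
    with z[OF c, of "\<lambda>i w. \<Psi> w (qshift a p i f)"] show ?thesis
      by (simp add: \<Psi>_def qword_butlast)
  qed
  have one: "1 \<in> deg_below ?d"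
    using deg_below_const[of 1 "?d - 1"] d by simp
  define v where "v = vec n (\<lambda>c. \<Psi> (e c) 1)"
  have v: "v \<in> carrier_vec n" and v_idx: "\<And>c. c < n \<Longrightarrow> v $ c = \<Psi> (e c) 1"
    by (simp_all add: v_def)
  have coord: "eval_coord n X v f c = \<Psi> (e c) f" if "f \<in> deg_below m" "m \<le> ?d" "c < n" for f c m
    using that
  proof (induction m arbitrary: f c)
    case 0
    then show ?case by (simp add: eval_coord_0 \<Psi>_def F_0)
  next
    case (Suc m)
    let ?k = "eval_point f a"
    have f: "f \<in> deg_below ?d" using Suc.prems deg_below_mono by blast
    have "eval_coord n X v f c = eval_coord n X v (nc_const ?k + (\<Sum>i\<in>UNIV. shifted_var a i * left_quot a i f)) c"
      using left_quot_expansion[of f a] by simp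
    also have "\<dots> = ?k * v $ c + (\<Sum>i\<in>UNIV. \<Sum>b<n. ?Y i c b * eval_coord n X v (left_quot a i f) b)"
      using Suc.prems(3)
      by (simp add: eval_coord_add eval_coord_sum eval_coord_const eval_coord_shifted[of X n, OF X])
    also have "\<dots> = ?k * \<Psi> (e c) 1 + (\<Sum>i\<in>UNIV. \<Sum>b<n. ?Y i c b * \<Psi> (e b) (left_quot a i f))"
      using Suc.IH left_quot_deg_below[OF Suc.prems(1)] Suc.prems(2,3) by (simp add: v_idx)
    \<comment> \<open>The row relation for 1 rewrites the constant part; added to the quotients of
      \<open>f\<close>, it turns \<open>left_quot\<close> into \<open>qshift\<close>.\<close>
    also have "\<Psi> (e c) 1 = (\<Sum>i\<in>UNIV. \<Sum>b<n. ?Y i c b * \<Psi> (e b) (qshift a p i 1))"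
      by (rule step[OF Suc.prems(3) one, symmetric])
    also have "?k * \<dots> + (\<Sum>i\<in>UNIV. \<Sum>b<n. ?Y i c b * \<Psi> (e b) (left_quot a i f))
        = (\<Sum>i\<in>UNIV. \<Sum>b<n. ?Y i c b * \<Psi> (e b) (left_quot a i f + nc_const ?k * qshift a p i 1))"
      unfolding sum_distrib_left sum.distrib[symmetric] \<Psi>_add \<Psi>_scale
      by (intro sum.cong refl) (simp add: distrib_left mult.left_commute)
    also have "\<dots> = \<Psi> (e c) f"
      unfolding qshift_left_quot[of a p _ f, symmetric] by (rule step[OF Suc.prems(3) f])
    finally show ?case .
  qed
  \<comment> \<open>In the expansion of 1 by \<open>qshift\<close>, the shifted variables already
    account for all of \<open>v\<close>, so the remaining multiple of p(X)v is zero.\<close>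
  have "eval_coord n X v p c = 0" if c: "c < n" for c
  proof -
    have "\<Psi> (e c) 1 = eval_coord n X v ((\<Sum>i\<in>UNIV. shifted_var a i * qshift a p i 1)
        + nc_const (1 / eval_point p a) * p) c"
      using qshift_expansion[OF pa, of 1] c by (simp add: eval_coord_1 v_idx)
    also have "\<dots> = (\<Sum>i\<in>UNIV. \<Sum>b<n. ?Y i c b * eval_coord n X v (qshift a p i 1) b)
        + 1 / eval_point p a * eval_coord n X v p c"
      using c by (simp add: eval_coord_add eval_coord_sum eval_coord_scale eval_coord_shifted[of X n, OF X])
    also have "(\<Sum>i\<in>UNIV. \<Sum>b<n. ?Y i c b * eval_coord n X v (qshift a p i 1) b)
        = (\<Sum>i\<in>UNIV. \<Sum>b<n. ?Y i c b * \<Psi> (e b) (qshift a p i 1))"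
      using coord[OF qshift_deg_below[OF deg_below_nc_deg one] order_refl] by simp
    also have "\<dots> = \<Psi> (e c) 1" by (rule step[OF c one])
    finally show ?thesis using pa by simp
  qed
  then have "eval_mat n p X *\<^sub>v v = 0\<^sub>v n"
    using v by (intro eq_vecI) (simp_all add: eval_coord_eq del: index_mult_mat_vec)
  \<comment> \<open>\<open>F\<close> may vanish at 1, so a polynomial \<open>r\<^sub>0\<close> with
    nonzero value is used: that value is the entry of its evaluation applied to \<open>v\<close> in
    the row of the empty word.\<close>
  moreover have "v \<noteq> 0\<^sub>v n"
  proof
    assume "v = 0\<^sub>v n"
    obtain c where c: "c < n" "e c = []" using companion_nonempty[OF comp] .
    have "eval_coord n X v r\<^sub>0 c = 0" using c(1) by (simp add: \<open>v = 0\<^sub>v n\<close> eval_coord_def)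
    with coord[OF r0(1) order_refl c(1)] c(2) r0(2) show False by (simp add: \<Psi>_def)
  qed
  ultimately show ?thesis using v by (auto simp: det_eval_mat_eq_0_iff)
qed

subsection \<open>Stable association preserves singularity\<close>

text \<open>\<open>block_act n X m M u\<close> is the product of the block matrix \<open>M(X)\<close> with a vector of \<open>m\<close> blocks of length \<open>n\<close>.\<close>

definition block_act ::
    "nat \<Rightarrow> ('g \<Rightarrow> 'k mat) \<Rightarrow> nat \<Rightarrow> ('g, 'k::field) free_algebra mat \<Rightarrow> (nat \<Rightarrow> nat \<Rightarrow> 'k) \<Rightarrow> nat \<Rightarrow> nat \<Rightarrow> 'k" where
  "block_act n X m M u i c = (\<Sum>j<m. \<Sum>b<n. eval_mat n (M $$ (i, j)) X $$ (c, b) * u j b)"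

lemma eval_mat_sum_index:
  assumes "c < n" "b < n"
  shows "eval_mat n (sum f A) X $$ (c, b) = (\<Sum>x\<in>A. eval_mat n (f x) X $$ (c, b))"
  using assms by (induction A rule: infinite_finite_induct) (simp_all add: eval_mat_0 eval_mat_add)

lemma eval_mat_mult_index:
  assumes "\<And>i. X i \<in> carrier_mat n n" "c < n" "b < n"
  shows "eval_mat n (f * g) X $$ (c, b) = (\<Sum>k<n. eval_mat n f X $$ (c, k) * eval_mat n g X $$ (k, b))"
  using assms(2,3) by (simp add: eval_mat_mult[of X n, OF assms(1)] scalar_prod_def lessThan_atLeast0)

lemma block_act_mult:
  assumes X: "\<And>i. X i \<in> carrier_mat n n"
    and M: "M \<in> carrier_mat m m" and N: "N \<in> carrier_mat m m" and ic: "i < m" "c < n"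
  shows "block_act n X m (M * N) u i c = block_act n X m M (block_act n X m N u) i c"
proof -
  have "block_act n X m (M * N) u i c
      = (\<Sum>l<m. \<Sum>b<n. \<Sum>j<m. \<Sum>k<n. eval_mat n (M $$ (i, j)) X $$ (c, k) * eval_mat n (N $$ (j, l)) X $$ (k, b) * u l b)"
    unfolding block_act_def
  proof (intro sum.cong refl)
    fix l b assume lb: "l \<in> {..<m}" "b \<in> {..<n}"
    have "(M * N) $$ (i, l) = (\<Sum>j<m. M $$ (i, j) * N $$ (j, l))"
      using M N ic lb by (simp add: scalar_prod_def lessThan_atLeast0)
    then show "eval_mat n ((M * N) $$ (i, l)) X $$ (c, b) * u l b
        = (\<Sum>j<m. \<Sum>k<n. eval_mat n (M $$ (i, j)) X $$ (c, k) * eval_mat n (N $$ (j, l)) X $$ (k, b) * u l b)"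
      using ic lb by (simp add: eval_mat_sum_index eval_mat_mult_index[of X n, OF X] sum_distrib_right)
  qed
  also have "\<dots> = (\<Sum>l<m. \<Sum>j<m. \<Sum>b<n. \<Sum>k<n. eval_mat n (M $$ (i, j)) X $$ (c, k) * eval_mat n (N $$ (j, l)) X $$ (k, b) * u l b)"
    by (rule sum.cong[OF refl], rule sum.swap)
  also have "\<dots> = (\<Sum>j<m. \<Sum>l<m. \<Sum>b<n. \<Sum>k<n. eval_mat n (M $$ (i, j)) X $$ (c, k) * eval_mat n (N $$ (j, l)) X $$ (k, b) * u l b)"
    by (rule sum.swap)
  also have "\<dots> = (\<Sum>j<m. \<Sum>l<m. \<Sum>k<n. \<Sum>b<n. eval_mat n (M $$ (i, j)) X $$ (c, k) * eval_mat n (N $$ (j, l)) X $$ (k, b) * u l b)"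
    by (rule sum.cong[OF refl], rule sum.cong[OF refl], rule sum.swap)
  also have "\<dots> = (\<Sum>j<m. \<Sum>k<n. \<Sum>l<m. \<Sum>b<n. eval_mat n (M $$ (i, j)) X $$ (c, k) * eval_mat n (N $$ (j, l)) X $$ (k, b) * u l b)"
    by (rule sum.cong[OF refl], rule sum.swap)
  also have "\<dots> = block_act n X m M (block_act n X m N u) i c"
    by (simp add: block_act_def sum_distrib_left mult.assoc)
  finally show ?thesis .
qed

lemma block_act_diag:
  assumes ic: "i < Suc d" "c < n"
  shows "block_act n X (Suc d) (diag_block_mat [mat_of_poly q, 1\<^sub>m d]) u i c
    = (if i = 0 then \<Sum>b<n. eval_mat n q X $$ (c, b) * u 0 b else u i c)"
proof -
  have entry: "diag_block_mat [mat_of_poly q, 1\<^sub>m d] $$ (i, j) = (if i = j then if i = 0 then q else 1 else 0)"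
    if "j < Suc d" for j
    using ic that by (auto simp: mat_of_poly_def)
  have "block_act n X (Suc d) (diag_block_mat [mat_of_poly q, 1\<^sub>m d]) u i c
      = (\<Sum>j<Suc d. if j = i then \<Sum>b<n. eval_mat n (if i = 0 then q else 1) X $$ (c, b) * u i b else 0)"
    unfolding block_act_def using ic
    by (intro sum.cong refl) (auto simp: entry eval_mat_0 simp del: diag_block_mat.simps)
  also have "\<dots> = (\<Sum>b<n. eval_mat n (if i = 0 then q else 1) X $$ (c, b) * u i b)"
    using ic by (simp del: sum.lessThan_Suc)
  also have "\<dots> = (if i = 0 then \<Sum>b<n. eval_mat n q X $$ (c, b) * u 0 b else u i c)"
  proof -
    have "(\<Sum>b<n. 1\<^sub>m n $$ (c, b) * u i b) = (\<Sum>b<n. if c = b then u i b else 0)"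
      using ic by (intro sum.cong) auto
    with ic show ?thesis by (simp add: eval_mat_1)
  qed
  finally show ?thesis .
qed

lemma block_act_one:
  assumes "i < m" "c < n"
  shows "block_act n X m (1\<^sub>m m) u i c = u i c"
proof -
  have "block_act n X m (1\<^sub>m m) u i c = (\<Sum>j<m. \<Sum>b<n. if j = i then if b = c then u j b else 0 else 0)"
    unfolding block_act_def using assms
    by (intro sum.cong refl) (auto simp: eval_mat_0 eval_mat_1)
  also have "\<dots> = (\<Sum>j<m. if j = i then u i c else 0)"
    using assms by (intro sum.cong refl) auto
  finally show ?thesis using assms by simp
qed

lemma block_act_zero:
  assumes "\<And>j b. j < m \<Longrightarrow> b < n \<Longrightarrow> u j b = 0"
  shows "block_act n X m M u i c = 0"
  using assms by (simp add: block_act_def)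

lemma invertible_matE:
  assumes "invertible_mat P" "P \<in> carrier_mat m m"
  obtains P' where "P' \<in> carrier_mat m m" "P * P' = 1\<^sub>m m" "P' * P = 1\<^sub>m m"
proof -
  from assms obtain B where B: "P * B = 1\<^sub>m m" "B * P = 1\<^sub>m (dim_row B)"
    by (auto simp: invertible_mat_def inverts_mat_def)
  then have "dim_col B = m" "dim_row B = m"
    using assms(2) by (metis index_mult_mat(3) index_one_mat(3), metis carrier_matD(2) index_mult_mat(3) index_one_mat(3))
  then show ?thesis using B by (intro that[of B]) auto
qed

text \<open>A kernel vector of p(X), padded by zeros, is killed by the enlarged matrix of
  \<open>p\<close>. Q(X) carries it to a kernel vector for \<open>q\<close>, whose identity blocks
  leave only the first component.\<close>

lemma stably_associated_singular:
  fixes p q :: "('g, 'k::field) free_algebra"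
  assumes sa: "stably_associated (mat_of_poly p) (mat_of_poly q)"
    and X: "\<And>i. X i \<in> carrier_mat n n" and sing: "det (eval_mat n p X) = 0"
  shows "det (eval_mat n q X) = 0"
proof -
  let ?D = "\<lambda>f d. diag_block_mat [mat_of_poly f, 1\<^sub>m d]"
  have dim: "dim_row (mat_of_poly f) = 1" for f :: "('g, 'k) free_algebra"
    by (simp add: mat_of_poly_def)
  \<comment> \<open>Both matrices have size 1, so the two paddings have the same size
    \<open>d\<close>.\<close>
  from sa obtain d P Q where P: "P \<in> carrier_mat (Suc d) (Suc d)" "invertible_mat P"
    and Q: "Q \<in> carrier_mat (Suc d) (Suc d)" "invertible_mat Q"
    and eq: "?D p d = P * ?D q d * Q"
    unfolding stably_associated_def dim by auto
  let ?act = "block_act n X (Suc d)"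
  have D: "?D q d \<in> carrier_mat (Suc d) (Suc d)" by (rule carrier_matI) (simp_all add: mat_of_poly_def)
  obtain P' where P': "P' \<in> carrier_mat (Suc d) (Suc d)" "P' * P = 1\<^sub>m (Suc d)"
    using invertible_matE[OF P(2,1)] by metis
  obtain Q' where Q': "Q' \<in> carrier_mat (Suc d) (Suc d)" "Q' * Q = 1\<^sub>m (Suc d)"
    using invertible_matE[OF Q(2,1)] by metis
  from sing obtain v where v: "v \<in> carrier_vec n" "v \<noteq> 0\<^sub>v n" "eval_mat n p X *\<^sub>v v = 0\<^sub>v n"
    by (auto simp: det_eval_mat_eq_0_iff)
  define w where "w j b = (if j = 0 then v $ b else 0)" for j b :: nat
  define u where "u = ?act Q w"
  have pv: "(\<Sum>b<n. eval_mat n p X $$ (c, b) * v $ b) = 0" if "c < n" for c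
    using that v eval_coord_eq[OF v(1) that, of p X] by (simp add: eval_coord_def)
  have "?act (?D p d) w i c = 0" if "i < Suc d" "c < n" for i c
    unfolding block_act_diag[OF that] using that pv by (simp add: w_def)
  then have "?act (P * ?D q d * Q) w i c = 0" if "i < Suc d" "c < n" for i c
    using that unfolding eq by blast
  then have Pz: "?act P (?act (?D q d) u) i c = 0" if "i < Suc d" "c < n" for i c
    using that block_act_mult[of X n, OF X mult_carrier_mat[OF P(1) D] Q(1) that, where u = w]
      block_act_mult[of X n, OF X P(1) D that, where u = u]
    by (simp only: u_def)
  have Du: "?act (?D q d) u i c = 0" if "i < Suc d" "c < n" for i c
  proof -
    have "?act (?D q d) u i c = ?act (P' * P) (?act (?D q d) u) i c"
      using that by (simp add: P' block_act_one)
    also have "\<dots> = ?act P' (?act P (?act (?D q d) u)) i c"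
      by (rule block_act_mult[of X n, OF X P'(1) P(1) that])
    also have "\<dots> = 0" by (rule block_act_zero) (rule Pz)
    finally show ?thesis .
  qed
  have u_pos: "u i c = 0" if "0 < i" "i < Suc d" "c < n" for i c
    using Du[OF that(2,3)] that unfolding block_act_diag[OF that(2,3)] by simp
  have u_0: "(\<Sum>b<n. eval_mat n q X $$ (c, b) * u 0 b) = 0" if "c < n" for c
    using Du[OF zero_less_Suc that] unfolding block_act_diag[OF zero_less_Suc that] by simp
  define y where "y = vec n (u 0)"
  have "y \<noteq> 0\<^sub>v n"
  proof
    assume "y = 0\<^sub>v n"
    then have "u 0 b = 0" if "b < n" for b
      using that by (metis y_def index_vec index_zero_vec(1))
    with u_pos have u: "u j b = 0" if "j < Suc d" "b < n" for j b
      using that by (cases "j = 0") auto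
    have "v $ c = 0" if "c < n" for c
    proof -
      have "v $ c = ?act (Q' * Q) w 0 c" using that by (simp add: Q' block_act_one w_def)
      also have "\<dots> = ?act Q' u 0 c"
        unfolding u_def using that by (intro block_act_mult X Q' Q) simp_all
      also have "\<dots> = 0" by (rule block_act_zero) (rule u)
      finally show ?thesis .
    qed
    with v show False by auto
  qed
  moreover have "eval_mat n q X *\<^sub>v y = 0\<^sub>v n"
    using u_0 by (intro eq_vecI) (simp_all add: y_def scalar_prod_def lessThan_atLeast0)
  ultimately show ?thesis by (auto simp: det_eval_mat_eq_0_iff y_def intro!: bexI[of _ y])
qed

subsection \<open>Inclusion of free loci\<close>

text \<open>On the line through \<open>a\<close> and \<open>b\<close> both values are polynomials in
  one parameter, nonzero at 0 and at 1 respectively. Their product has finitely many roots, and the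
  field is infinite.\<close>

lemma common_nonvanishing_point:
  fixes f g :: "('g, 'k::{field, ring_char_0}) free_algebra"
  assumes "eval_point f a \<noteq> 0" "eval_point g b \<noteq> 0"
  obtains c where "eval_point f c \<noteq> 0" "eval_point g c \<noteq> 0"
proof -
  let ?line = "\<lambda>t i. a i + t * (b i - a i)"
  define R where "R h = (\<Sum>w\<in>Poly_Mapping.keys h. [:Poly_Mapping.lookup h w:] *
      prod_list (map (\<lambda>i. [:a i, b i - a i:]) (letters w)))" for h :: "('g, 'k) free_algebra"
  have word: "poly (prod_list (map (\<lambda>i. [:a i, b i - a i:]) l)) t = prod_list (map (?line t) l)" for l t
    by (induction l) (simp_all add: algebra_simps)
  have R: "poly (R h) t = eval_point h (?line t)" for h t
    by (simp add: R_def eval_point_def poly_sum word)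
  have "poly (R f) 0 \<noteq> 0" "poly (R g) 1 \<noteq> 0"
    using assms by (simp_all add: R)
  then have "R f * R g \<noteq> 0" by auto
  then have "finite {t. poly (R f * R g) t = 0}" by (rule poly_roots_finite)
  then have "{t. poly (R f * R g) t = 0} \<noteq> UNIV"
    using infinite_UNIV_char_0 by metis
  then obtain t where "poly (R f * R g) t \<noteq> 0" by blast
  then show ?thesis using that[of "?line t"] by (simp add: R)
qed

lemma singular_separation:
  fixes p :: "('g::finite, 'k::field) free_algebra"
  assumes p: "nc_irreducible p" "eval_point p a \<noteq> 0"
    and qs: "\<And>q. q \<in> set qs \<Longrightarrow> nc_irreducible q" "\<And>q. q \<in> set qs \<Longrightarrow> eval_point q a \<noteq> 0"
      "\<And>q. q \<in> set qs \<Longrightarrow> \<not> stably_associated (mat_of_poly p) (mat_of_poly q)"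
  obtains n X where "1 \<le> n" "\<And>i. X i \<in> carrier_mat n n" "det (eval_mat n p X) = 0"
    "\<And>q. q \<in> set qs \<Longrightarrow> det (eval_mat n q X) \<noteq> 0"
proof -
  have deg_pos: "nc_deg f > 0" if "nc_irreducible f" for f :: "('g, 'k) free_algebra"
    using that by (simp add: nc_irreducible_def nonconstant_iff_nc_deg)
  obtain s where s: "s \<in> deg_below (nc_deg p)" "s \<noteq> 0"
    and simple: "\<And>h. qact a p h s \<noteq> 0 \<Longrightarrow> \<exists>g. qact a p (g * h) s = s"
    using simple_vector_exists[OF deg_pos[OF p(1)], where a = a] by metis
  \<comment> \<open>If every variable killed \<open>s\<close>, all coordinates of \<open>s\<close>
    would vanish and \<open>s\<close> would be a multiple of \<open>p\<close> of too small a
    degree.\<close>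
  have moved: "\<exists>h. Poly_Mapping.lookup h 0 = 0 \<and> qact a p h s \<noteq> 0"
  proof (rule ccontr)
    assume "\<not> ?thesis"
    moreover have "Poly_Mapping.lookup (nc_var i :: ('g, 'k) free_algebra) 0 = 0" for i
      by (simp add: nc_var_def lookup_single zero_free_monoid_def when_def)
    ultimately have "qshift a p i s = 0" for i by (auto simp flip: qact_var)
    then have "\<forall>i. qshift a p i s \<in> range (\<lambda>r. r * p)" by (metis mult_zero_left rangeI)
    then have "s \<in> range (\<lambda>r. r * p)" using qshift_multiple_iff[OF p(2)] by blast
    with multiple_deg_below s show False by blast
  qed
  define words :: "nat \<Rightarrow> 'g free_monoid set" where "words d = {w. length (letters w) < d}" for d
  have fin: "finite (words d)" for d unfolding words_def by (rule finite_words)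
  \<comment> \<open>The list \<open>ts\<close> collects the word basis of each
    \<open>V\<^sub>q\<close>, so killing its entries means annihilating these modules.\<close>
  have "finite (\<Union>q\<in>set qs. (\<lambda>w. (q, Poly_Mapping.single w (1::'k))) ` words (nc_deg q))"
    using fin by blast
  then obtain ts where ts: "set ts = (\<Union>q\<in>set qs. (\<lambda>w. (q, Poly_Mapping.single w (1::'k))) ` words (nc_deg q))"
    by (rule exE[OF finite_list])
  from moved show ?thesis
  proof (cases rule: annihilator_dichotomy[where ts = ts])
    case (annihilator h')
    \<comment> \<open>Simplicity improves moving \<open>s\<close> to fixing \<open>s\<close>; left
      multiplication by \<open>g\<close> preserves the annihilation and the zero constant
      term.\<close>
    from simple[OF annihilator(2)] obtain g where g: "qact a p (g * h') s = s" by blast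
    define h where "h = g * h'"
    have h0: "Poly_Mapping.lookup h 0 = 0" by (simp add: h_def lookup_mult_0 annihilator(1))
    have ann: "qact a q h t = 0" if q: "q \<in> set qs" and t: "t \<in> deg_below (nc_deg q)" for q t
    proof -
      have single: "qact a q h (Poly_Mapping.single w 1) = 0" if "w \<in> words (nc_deg q)" for w
        using that q annihilator(3) ts by (fastforce simp: h_def qact_mult)
      have "qact a q h t = (\<Sum>w\<in>Poly_Mapping.keys t.
          nc_const (Poly_Mapping.lookup t w) * qact a q h (Poly_Mapping.single w 1))"
        by (simp add: nc_const_single sum_single_lookup flip: qact_scale qact_sum)
      also have "\<dots> = 0"
        using t by (intro sum.neutral ballI) (auto simp: deg_below_def words_def single)
      finally show ?thesis .
    qed
    obtain n X e where comp: "companion a h n X e" using companion_exists[OF h0] .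
    show ?thesis
    proof (rule that[of n X])
      show "1 \<le> n" by (rule companion_nonempty[OF comp]) simp
      show "X i \<in> carrier_mat n n" for i using comp by (simp add: companion_def)
      show "det (eval_mat n p X) = 0"
        by (rule companion_singular[OF comp h0 p(2) deg_pos[OF p(1)] s]) (simp add: h_def g)
      show "det (eval_mat n q X) \<noteq> 0" if "q \<in> set qs" for q
        by (rule companion_nonsingular[OF comp h0 qs(2)[OF that] deg_pos[OF qs(1)[OF that]]])
          (rule ann[OF that])
    qed
  next
    case (morphism q t L)
    then obtain w where q: "q \<in> set qs" and t: "t \<in> deg_below (nc_deg q)"
      unfolding ts words_def by (auto intro: deg_below_single)
    from morphism(4) obtain h where "h \<in> L" "qact a p h s \<noteq> 0" by blast
    then have "stably_associated (mat_of_poly p) (mat_of_poly q)"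
      using stably_associated_of_morphism[OF p(1) qs(1)[OF q] p(2) qs(2)[OF q] s(1) t morphism(2,3) _ _ morphism(5)]
      by blast
    with qs(3)[OF q] show ?thesis by blast
  qed
qed

section \<open>Factorizations under evaluation, and the comparison of free loci\<close>

lemma eval_point_prod_list: "eval_point (prod_list qs) a = (\<Prod>q\<leftarrow>qs. eval_point q a)"
  by (induction qs) simp_all

lemma irreducible_factorE:
  assumes "irreducible_factor p f"
  obtains qs q c where "\<forall>r\<in>set qs. nc_irreducible r" "f = prod_list qs" "q \<in> set qs" "c \<noteq> 0"
    "p = nc_const c * q" "nc_irreducible p"
  using assms unfolding irreducible_factor_def by (metis nc_irreducible_scale)

lemma irreducible_factorI:
  "\<forall>r\<in>set qs. nc_irreducible r \<Longrightarrow> q \<in> set qs \<Longrightarrow> irreducible_factor q (prod_list qs)"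
  unfolding irreducible_factor_def by (intro exI[of _ qs] exI[of _ q] exI[of _ 1]) simp

lemma det_eval_mat_irreducible_factor:
  assumes "irreducible_factor p f" and X: "\<And>i. X i \<in> carrier_mat n n" and "det (eval_mat n p X) = 0"
  shows "det (eval_mat n f X) = 0"
proof -
  from assms(1) obtain qs q c where *: "f = prod_list qs" "q \<in> set qs" "c \<noteq> 0" "p = nc_const c * q"
    by (rule irreducible_factorE)
  then have "det (eval_mat n q X) = 0"
    using assms(3) by (simp add: eval_mat_scale)
  with * show ?thesis
    by (auto simp: eval_mat_prod_list[of X n, OF X] prod_list_zero_iff)
qed

text \<open>A constant other than 0 and 1 is no product of irreducible polynomials, so constants get
  a case of their own.\<close>

lemma factorization_cases:
  fixes f :: "('g, 'k::field) free_algebra"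
  assumes "f \<noteq> 0"
  obtains c where "c \<noteq> 0" "f = nc_const c"
  | qs where "\<forall>q\<in>set qs. nc_irreducible q" "f = prod_list qs"
  using assms factorization_exists[OF assms] by (cases "nonconstant f") (auto simp: nonconstant_def)

theorem theorem2:
  fixes f\<^sub>1 f\<^sub>2 :: "('g::finite, 'k::{alg_closed_field, field_char_0}) free_algebra"
  assumes "range (eval_point f\<^sub>1) \<noteq> {0}"
    and "range (eval_point f\<^sub>2) \<noteq> {0}"
  shows "free_locus f\<^sub>1 \<subseteq> free_locus f\<^sub>2 \<longleftrightarrow>
    (\<forall>p. irreducible_factor p f\<^sub>1 \<longrightarrow>
      (\<exists>q. irreducible_factor q f\<^sub>2 \<and> stably_associated (mat_of_poly p) (mat_of_poly q)))"
proof -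
  have nonzero: "\<exists>a. eval_point f a \<noteq> 0" if "range (eval_point f) \<noteq> {0}"
    for f :: "('g, 'k) free_algebra" using that by auto
  obtain a where a: "eval_point f\<^sub>1 a \<noteq> 0" "eval_point f\<^sub>2 a \<noteq> 0"
    using nonzero[OF assms(1)] nonzero[OF assms(2)] common_nonvanishing_point by metis
  then have nz: "f\<^sub>1 \<noteq> 0" "f\<^sub>2 \<noteq> 0" by auto
  have locus: "X \<in> free_locus f \<longleftrightarrow> (\<exists>n\<ge>1. (\<forall>i. X i \<in> carrier_mat n n) \<and> det (eval_mat n f X) = 0)"
    for f :: "('g, 'k) free_algebra" and X
    by (auto simp: free_locus_def free_locus_at_def)
  have const: "det (eval_mat n (nc_const c) X) \<noteq> 0" if "c \<noteq> 0" for n X and c :: 'k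
    using that by (simp add: eval_mat_const)
  show ?thesis
  proof
    assume sub: "free_locus f\<^sub>1 \<subseteq> free_locus f\<^sub>2"
    show "\<forall>p. irreducible_factor p f\<^sub>1 \<longrightarrow>
      (\<exists>q. irreducible_factor q f\<^sub>2 \<and> stably_associated (mat_of_poly p) (mat_of_poly q))"
    proof (intro allI impI, rule ccontr)
      fix p assume p: "irreducible_factor p f\<^sub>1"
        and not: "\<not> (\<exists>q. irreducible_factor q f\<^sub>2 \<and> stably_associated (mat_of_poly p) (mat_of_poly q))"
      from p obtain qs q c where *: "f\<^sub>1 = prod_list qs" "q \<in> set qs" "c \<noteq> 0" "p = nc_const c * q"
        and irr: "nc_irreducible p"
        by (rule irreducible_factorE)
      then have pa: "eval_point p a \<noteq> 0"
        using a(1) by (auto simp: eval_point_prod_list prod_list_zero_iff)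
      \<comment> \<open>A constant polynomial is given the empty list, so that no factors have to be
        avoided.\<close>
      obtain qs\<^sub>2 where qs2: "\<forall>q\<in>set qs\<^sub>2. nc_irreducible q"
        and f2: "f\<^sub>2 = prod_list qs\<^sub>2 \<or> qs\<^sub>2 = [] \<and> (\<exists>c. c \<noteq> 0 \<and> f\<^sub>2 = nc_const c)"
        using nz(2) by (cases f\<^sub>2 rule: factorization_cases) (force, blast)
      have qs2a: "eval_point q a \<noteq> 0" if "q \<in> set qs\<^sub>2" for q
        using that f2 a(2) by (auto simp: eval_point_prod_list prod_list_zero_iff)
      have nsa: "\<not> stably_associated (mat_of_poly p) (mat_of_poly q)" if "q \<in> set qs\<^sub>2" for q
        using that f2 not irreducible_factorI[OF qs2 that] by auto
      obtain n X where X: "1 \<le> n" "\<And>i. X i \<in> carrier_mat n n"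
        and sing: "det (eval_mat n p X) = 0" and nonsing: "\<And>q. q \<in> set qs\<^sub>2 \<Longrightarrow> det (eval_mat n q X) \<noteq> 0"
        by (rule singular_separation[OF irr pa bspec[OF qs2] qs2a nsa])
          (assumption+, (rule that; assumption))
      have "X \<in> free_locus f\<^sub>1"
        unfolding locus using X det_eval_mat_irreducible_factor[OF p X(2) sing] by blast
      with sub have "X \<in> free_locus f\<^sub>2" by blast
      then obtain m where m: "\<forall>i. X i \<in> carrier_mat m m" "det (eval_mat m f\<^sub>2 X) = 0"
        unfolding locus by blast
      \<comment> \<open>There is at least one variable, so the tuple determines the size of its
        matrices.\<close>
      with X(2) have "m = n" by (metis carrier_matD(1))
      moreover have "det (eval_mat n f\<^sub>2 X) \<noteq> 0"
        using f2 const nonsing by (auto simp: eval_mat_prod_list[of X n, OF X(2)] prod_list_zero_iff)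
      ultimately show False using m(2) by simp
    qed
  next
    assume R: "\<forall>p. irreducible_factor p f\<^sub>1 \<longrightarrow>
      (\<exists>q. irreducible_factor q f\<^sub>2 \<and> stably_associated (mat_of_poly p) (mat_of_poly q))"
    show "free_locus f\<^sub>1 \<subseteq> free_locus f\<^sub>2"
    proof
      fix X assume "X \<in> free_locus f\<^sub>1"
      then obtain n where n: "1 \<le> n" "\<And>i. X i \<in> carrier_mat n n" "det (eval_mat n f\<^sub>1 X) = 0"
        unfolding locus by blast
      from nz(1) show "X \<in> free_locus f\<^sub>2"
      proof (cases f\<^sub>1 rule: factorization_cases)
        case (1 c)
        with const n(3) show ?thesis by blast
      next
        case (2 qs)
        \<comment> \<open>The determinant is multiplicative, so some factor is singular at
          \<open>X\<close>, and stable association passes this on at the same point.\<close>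
        with n obtain p where p: "p \<in> set qs" "det (eval_mat n p X) = 0"
          by (auto simp: eval_mat_prod_list[of X n, OF n(2)] prod_list_zero_iff)
        with 2 R irreducible_factorI obtain q where
          q: "irreducible_factor q f\<^sub>2" "stably_associated (mat_of_poly p) (mat_of_poly q)"
          by blast
        from det_eval_mat_irreducible_factor[OF q(1) n(2) stably_associated_singular[OF q(2) n(2) p(2)]]
        show ?thesis unfolding locus using n by blast
      qed
    qed
  qed
qed

end
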